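(* Let $m\ge1$, $X=\{x_0,\dots,x_m\}$, and let $(H,\mu,\Delta)$ be the Hopf algebra of the output feedback group (defined in the context). The antipode $S$ of any $a^i_\eta\in V_+$ can be computed by the following algorithm. (i) Recursively compute the maps $\Delta^j_{\sqcup\!\sqcup}$ on $V_+$, $j=1,\dots,m$, by $$\Delta^j_{\sqcup\!\sqcup}a^i_\emptyset=a^i_\emptyset\otimes a^j_\emptyset,\qquad \Delta^j_{\sqcup\!\sqcup}\circ\theta_k=(\theta_k\otimes\mathrm{id}+\mathrm{id}\otimes\theta_k)\circ\Delta^j_{\sqcup\!\sqcup},\quad k=0,\dots,m.$$ (ii) Recursively compute $\tilde\Delta$ on $V_+$ by $$\tilde\Delta a^i_\emptyset=a^i_\emptyset\otimes\mathbf{1},\qquad \tilde\Delta\circ\theta_l=(\theta_l\otimes\mathrm{id})\circ\tilde\Delta\ (l=1,\dots,m),$$ $$\tilde\Delta\circ\theta_0=(\theta_0\otimes\mathrm{id})\circ\tilde\Delta+\sum_{l=1}^m(\theta_l\otimes\mu)\circ(\tilde\Delta\otimes\mathrm{id})\circ\Delta^l_{\sqcup\!\sqcup}.$$ (iii) Recursively compute $S$ by $$S a^i_\eta=-a^i_\eta-\sum (S a'_{(1)})\,a'_{(2)}=-a^i_\eta-\sum a'_{(1)}\,S a'_{(2)},$$ where $\Delta' a^i_\eta=\tilde\Delta a^i_\eta-a^i_\eta\otimes\mathbf{1}=\sum a'_{(1)}\otimes a'_{(2)}$.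
   Context: $X=\{x_0,\dots,x_m\}$ is an alphabet of noncommuting letters, $X^*$ the monoid of words including the empty word $\emptyset$, $|\eta|_{x_i}$ the number of occurrences of $x_i$ in $\eta$. $\mathbb{R}^\ell\langle\langle X\rangle\rangle$ is the set of formal power series $c:X^*\to\mathbb{R}^\ell$, $c=\sum_{\eta}(c,\eta)\eta$; $c_i$ is the $i$-th component series. The shuffle product $\sqcup\!\sqcup$ is the bilinear product with $(x_i\eta)\sqcup\!\sqcup(x_j\xi)=x_i(\eta\sqcup\!\sqcup(x_j\xi))+x_j((x_i\eta)\sqcup\!\sqcup\xi)$, $\eta\sqcup\!\sqcup\emptyset=\emptyset\sqcup\!\sqcup\eta=\eta$. Modified composition product: for $c\in\mathbb{R}^\ell\langle\langle X\rangle\rangle$, $d\in\mathbb{R}^m\langle\langle X\rangle\rangle$, $c\,\tilde\circ\,d=\sum_{\eta\in X^*}(c,\eta)\,\phi_d(\eta)(1)$, where $\phi_d$ is the continuous (in the ultrametric sense) algebra homomorphism from $\mathbb{R}\langle\langle X\rangle\rangle$ to $\mathrm{End}(\mathbb{R}\langle\langle X\rangle\rangle)$ with $\phi_d(x_i\eta)=\phi_d(x_i)\circ\phi_d(\eta)$, $\phi_d(x_i)(e)=x_ie+x_0(d_i\sqcup\!\sqcup e)$ for $i=0,\dots,m$ with $d_0:=0$, and $\phi_d(\emptyset)=\mathrm{id}$. For $c,d\in\mathbb{R}^m\langle\langle X\rangle\rangle$ set $c\circledcirc d:=d+c\,\tilde\circ\,d$. Coordinate maps: $a^i_\eta:\mathbb{R}^m\langle\langle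 X\rangle\rangle\to\mathbb{R}$, $c\mapsto(c_i,\eta)$, for $\eta\in X^*$, $i=1,\dots,m$, with degree $\deg(a^i_\eta)=2|\eta|_{x_0}+\sum_{j=1}^m|\eta|_{x_j}+1$. $V_+$ is the real span of all $a^i_\eta$. $H$ is the free unital commutative $\mathbb{R}$-algebra generated by the $a^i_\eta$, with product $\mu$, unit $\mathbf{1}$ (the function constantly $1$), graded by $\deg(a^i_\eta a^j_\xi)=\deg(a^i_\eta)+\deg(a^j_\xi)$, $\deg(\mathbf 1)=0$. Elements of $H$ are functions on $\mathbb{R}^m\langle\langle X\rangle\rangle$ and elements of $H\otimes H$ functions of two series via $(f\otimes g)(c,d)=f(c)g(d)$. The coproduct $\Delta$ on $H$ is the unital algebra morphism with $\Delta a^i_\eta(c,d)=((c\circledcirc d)_i,\eta)$; the counit satisfies $\varepsilon(a^i_\eta)=0$, $\varepsilon(\mathbf{1})=1$. $(H,\mu,\Delta)$ is a connected graded Hopf algebra, and $S$ is its antipode. The map $\tilde\Delta:V_+\to V_+\otimes H$ is $\tilde\Delta a^i_\eta=\Delta a^i_\eta-\mathbf{1}\otimes a^i_\eta$, equivalently $\tilde\Delta a^i_\eta(c,d)=((c\,\tilde\circ\,d)_i,\eta)$. $\theta_k$ is the endomorphism of $V_+$ given by $\theta_ka^i_\eta=a^i_{x_k\eta}$, $k=0,\dots,m$. The map $\Delta^j_{\sqcup\!\sqcup}:V_+\to V_+\otimes V_+$ is the one defined by the recursion in (i). *)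

theory Defs
  imports
    "HOL-Analysis.Analysis"
    "HOL-Library.Poly_Mapping"
    "HOL-Library.Groups_Big_Fun"
    "HOL-Library.Product_Plus"
begin

text \<open>
  The finite type \<open>'m\<close> plays the role of the index set \<open>{1,\<dots>,m}\<close>, so that \<open>m = CARD('m) \<ge> 1\<close>.
  The letter \<open>x\<^sub>0\<close> is \<^term>\<open>None\<close> and \<open>x\<^sub>i\<close>, \<open>i = 1,\<dots>,m\<close>, is \<^term>\<open>Some i\<close>.
\<close>

type_synonym 'm letter = "'m option"
type_synonym 'm word = "'m letter list"
type_synonym 'm scalar_series = "'m word \<Rightarrow> real"
type_synonym 'm series = "'m word \<Rightarrow> real ^ 'm"

definition component :: "'m::finite series \<Rightarrow> 'm \<Rightarrow> 'm scalar_series" where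
  "component c i = (\<lambda>\<eta>. c \<eta> $ i)"

definition one_series :: "'m scalar_series" where
  "one_series = (\<lambda>\<eta>. if \<eta> = [] then 1 else 0)"

fun lconcat :: "'m letter \<Rightarrow> 'm scalar_series \<Rightarrow> 'm scalar_series" where
  "lconcat x e [] = 0"
| "lconcat x e (y # \<nu>) = (if y = x then e \<nu> else 0)"

fun word_shuffle :: "'m word \<Rightarrow> 'm word \<Rightarrow> 'm scalar_series" where
  "word_shuffle [] \<xi> = (\<lambda>\<nu>. if \<nu> = \<xi> then 1 else 0)"
| "word_shuffle \<eta> [] = (\<lambda>\<nu>. if \<nu> = \<eta> then 1 else 0)"
| "word_shuffle (x # \<eta>) (y # \<xi>) =
     (\<lambda>\<nu>. lconcat x (word_shuffle \<eta> (y # \<xi>)) \<nu> + lconcat y (word_shuffle (x # \<eta>) \<xi>) \<nu>)"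

text \<open>
  \<^const>\<open>Sum_any\<close> is the sum over the support of its argument; the supports occurring in the next
  definition and in \<open>modified_comp\<close> are finite, see \<open>finite_shuffle_support\<close> and
  \<open>finite_modified_comp_support\<close>.
\<close>

definition shuffle :: "'m scalar_series \<Rightarrow> 'm scalar_series \<Rightarrow> 'm scalar_series" where
  "shuffle c d = (\<lambda>\<nu>. Sum_any (\<lambda>(\<xi>, \<zeta>). c \<xi> * d \<zeta> * word_shuffle \<xi> \<zeta> \<nu>))"

definition phi_letter :: "'m::finite series \<Rightarrow> 'm letter \<Rightarrow> 'm scalar_series \<Rightarrow> 'm scalar_series" where
  "phi_letter d x e = (\<lambda>\<nu>. lconcat x e \<nu> +
     lconcat None (shuffle (case x of None \<Rightarrow> (\<lambda>_. 0) | Some i \<Rightarrow> component d i) e) \<nu>)"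

primrec phi :: "'m::finite series \<Rightarrow> 'm word \<Rightarrow> 'm scalar_series \<Rightarrow> 'm scalar_series" where
  "phi d [] = id"
| "phi d (x # \<eta>) = phi_letter d x \<circ> phi d \<eta>"

definition modified_comp :: "'m::finite series \<Rightarrow> 'm series \<Rightarrow> 'm series" where
  "modified_comp c d = (\<lambda>\<nu>. Sum_any (\<lambda>\<eta>. phi d \<eta> one_series \<nu> *\<^sub>R c \<eta>))"

definition feedback_prod :: "'m::finite series \<Rightarrow> 'm series \<Rightarrow> 'm series" where
  "feedback_prod c d = (\<lambda>\<nu>. d \<nu> + modified_comp c d \<nu>)"

lemma word_shuffle_length: "word_shuffle \<xi> \<zeta> \<nu> \<noteq> 0 \<Longrightarrow> length \<nu> = length \<xi> + length \<zeta>"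
proof (induction \<xi> \<zeta> arbitrary: \<nu> rule: word_shuffle.induct)
  case (3 x \<eta> y \<xi>)
  show ?case
  proof (cases \<nu>)
    case Nil
    with "3.prems" show ?thesis by simp
  next
    case (Cons z \<nu>')
    with "3.prems" have "word_shuffle \<eta> (y # \<xi>) \<nu>' \<noteq> 0 \<or> word_shuffle (x # \<eta>) \<xi> \<nu>' \<noteq> 0"
      by (auto simp del: word_shuffle.simps(1,2) split: if_splits)
    then show ?thesis
    proof
      assume "word_shuffle \<eta> (y # \<xi>) \<nu>' \<noteq> 0"
      from "3.IH"(1)[OF this] show ?thesis by (simp add: Cons)
    next
      assume "word_shuffle (x # \<eta>) \<xi> \<nu>' \<noteq> 0"
      from "3.IH"(2)[OF this] show ?thesis by (simp add: Cons)
    qed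
  qed
qed (auto split: if_splits)

lemma finite_words_le: "finite {\<eta> :: 'm::finite word. length \<eta> \<le> n}"
  using finite_lists_length_le[of "UNIV :: 'm letter set" n] by simp

lemma finite_shuffle_support:
  fixes c d :: "'m::finite scalar_series"
  shows "finite {p. (case p of (\<xi>, \<zeta>) \<Rightarrow> c \<xi> * d \<zeta> * word_shuffle \<xi> \<zeta> \<nu>) \<noteq> 0}"
proof (rule finite_subset)
  show "finite ({\<eta> :: 'm word. length \<eta> \<le> length \<nu>} \<times> {\<eta> :: 'm word. length \<eta> \<le> length \<nu>})"
    by (intro finite_cartesian_product finite_words_le)
next
  show "{p. (case p of (\<xi>, \<zeta>) \<Rightarrow> c \<xi> * d \<zeta> * word_shuffle \<xi> \<zeta> \<nu>) \<noteq> 0}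
      \<subseteq> {\<eta> :: 'm word. length \<eta> \<le> length \<nu>} \<times> {\<eta> :: 'm word. length \<eta> \<le> length \<nu>}"
  proof
    fix p
    assume p: "p \<in> {p. (case p of (\<xi>, \<zeta>) \<Rightarrow> c \<xi> * d \<zeta> * word_shuffle \<xi> \<zeta> \<nu>) \<noteq> 0}"
    obtain \<xi> \<zeta> where eq: "p = (\<xi>, \<zeta>)" by (cases p)
    have "word_shuffle \<xi> \<zeta> \<nu> \<noteq> 0" using p by (simp add: eq)
    then have "length \<nu> = length \<xi> + length \<zeta>" by (rule word_shuffle_length)
    then show "p \<in> {\<eta>. length \<eta> \<le> length \<nu>} \<times> {\<eta>. length \<eta> \<le> length \<nu>}" by (simp add: eq)
  qed
qed

lemma shuffle_order:
  fixes c d :: "'m::finite scalar_series"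
  assumes "\<And>\<zeta>. length \<zeta> < n \<Longrightarrow> d \<zeta> = 0" "length \<nu> < n"
  shows "shuffle c d \<nu> = 0"
proof -
  have "(case p of (\<xi>, \<zeta>) \<Rightarrow> c \<xi> * d \<zeta> * word_shuffle \<xi> \<zeta> \<nu>) = 0" for p
  proof (cases p)
    case (Pair \<xi> \<zeta>)
    show ?thesis
    proof (cases "length \<zeta> < n")
      case False
      then have "word_shuffle \<xi> \<zeta> \<nu> = 0"
        using assms(2) word_shuffle_length[of \<xi> \<zeta> \<nu>] by linarith
      then show ?thesis by (simp add: Pair)
    qed (simp add: Pair assms(1))
  qed
  then show ?thesis unfolding shuffle_def by simp
qed

lemma phi_order: "length \<nu> < length \<eta> \<Longrightarrow> phi d \<eta> one_series \<nu> = 0"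
proof (induction \<eta> arbitrary: \<nu>)
  case (Cons x \<eta>)
  show ?case
  proof (cases \<nu>)
    case Nil
    then show ?thesis by (simp add: phi_letter_def)
  next
    case (Cons y \<nu>')
    then have len: "length \<nu>' < length \<eta>"
      using Cons.prems by simp
    have "phi d \<eta> one_series \<nu>' = 0"
      by (rule Cons.IH[OF len])
    moreover have "shuffle e (phi d \<eta> one_series) \<nu>' = 0" for e
      by (rule shuffle_order[OF Cons.IH len])
    ultimately show ?thesis
      unfolding Cons phi.simps phi_letter_def comp_def lconcat.simps by (simp only: if_cancel add_0)
  qed
qed (simp only: list.size not_less0)

lemma finite_modified_comp_support:
  fixes c d :: "'m::finite series"
  shows "finite {\<eta>. phi d \<eta> one_series \<nu> *\<^sub>R c \<eta> \<noteq> 0}"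
proof (rule finite_subset)
  show "finite {\<eta> :: 'm word. length \<eta> \<le> length \<nu>}" by (rule finite_words_le)
qed (use phi_order[of \<nu> _ d] not_less in auto)

instantiation poly_mapping :: (type, real_vector) real_vector
begin

definition scaleR_poly_mapping :: "real \<Rightarrow> ('a \<Rightarrow>\<^sub>0 'b) \<Rightarrow> 'a \<Rightarrow>\<^sub>0 'b" where
  "scaleR_poly_mapping r p = Poly_Mapping.map (\<lambda>v. r *\<^sub>R v) p"

lemma lookup_scaleR: "Poly_Mapping.lookup (r *\<^sub>R p) x = r *\<^sub>R Poly_Mapping.lookup p x"
  for p :: "'a \<Rightarrow>\<^sub>0 'b"
  by (simp add: scaleR_poly_mapping_def map.rep_eq when_def)

instance
  by standard (auto intro!: poly_mapping_eqI simp: lookup_scaleR lookup_add algebra_simps)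

end

definition basis :: "'a \<Rightarrow> 'a \<Rightarrow>\<^sub>0 real" where
  "basis x = Poly_Mapping.single x 1"

definition lin_ext :: "('a \<Rightarrow> 'b::real_vector) \<Rightarrow> ('a \<Rightarrow>\<^sub>0 real) \<Rightarrow> 'b" where
  "lin_ext f p = (\<Sum>x\<in>Poly_Mapping.keys p. Poly_Mapping.lookup p x *\<^sub>R f x)"

text \<open>
  If \<open>U\<close> and \<open>W\<close> are the real vector spaces with bases \<open>'a\<close> and \<open>'b\<close>, then \<open>U \<otimes> W\<close> is the one with
  basis \<open>'a \<times> 'b\<close>; \<open>tensor_map F G\<close> is \<open>F \<otimes> G\<close> for linear maps \<open>F\<close> and \<open>G\<close>.
\<close>

definition tensor :: "('a \<Rightarrow>\<^sub>0 real) \<Rightarrow> ('b \<Rightarrow>\<^sub>0 real) \<Rightarrow> ('a \<times> 'b) \<Rightarrow>\<^sub>0 real" where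
  "tensor p q = lin_ext (\<lambda>x. lin_ext (\<lambda>y. basis (x, y)) q) p"

definition tensor_map ::
  "(('a \<Rightarrow>\<^sub>0 real) \<Rightarrow> ('c \<Rightarrow>\<^sub>0 real)) \<Rightarrow> (('b \<Rightarrow>\<^sub>0 real) \<Rightarrow> ('d \<Rightarrow>\<^sub>0 real)) \<Rightarrow>
   (('a \<times> 'b) \<Rightarrow>\<^sub>0 real) \<Rightarrow> (('c \<times> 'd) \<Rightarrow>\<^sub>0 real)" where
  "tensor_map F G = lin_ext (\<lambda>(x, y). tensor (F (basis x)) (G (basis y)))"

definition tensor_assoc :: "((('a \<times> 'b) \<times> 'c) \<Rightarrow>\<^sub>0 real) \<Rightarrow> (('a \<times> ('b \<times> 'c)) \<Rightarrow>\<^sub>0 real)" where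
  "tensor_assoc = lin_ext (\<lambda>((x, y), z). basis (x, (y, z)))"

text \<open>
  The pair \<open>(i, \<eta>)\<close> stands for the coordinate map \<open>a\<^sup>i\<^sub>\<eta>\<close>. A monomial in the coordinate maps is its
  finitely supported exponent function, and \<open>H\<close>, the polynomial ring in the coordinate maps, is the
  monoid algebra of the monomials. Likewise \<open>H \<otimes> H\<close> is the monoid algebra of pairs of monomials; its
  ring structure is the usual one, \<open>(f \<otimes> g) * (f' \<otimes> g') = (f * f') \<otimes> (g * g')\<close>.
\<close>

type_synonym 'm coord = "'m \<times> 'm word"
type_synonym 'm monom = "'m coord \<Rightarrow>\<^sub>0 nat"
type_synonym 'm Vplus = "'m coord \<Rightarrow>\<^sub>0 real"
type_synonym 'm H = "'m monom \<Rightarrow>\<^sub>0 real"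
type_synonym 'm VV = "('m coord \<times> 'm coord) \<Rightarrow>\<^sub>0 real"
type_synonym 'm VH = "('m coord \<times> 'm monom) \<Rightarrow>\<^sub>0 real"
type_synonym 'm HH = "('m monom \<times> 'm monom) \<Rightarrow>\<^sub>0 real"

definition coord :: "'m \<Rightarrow> 'm word \<Rightarrow> 'm Vplus" where
  "coord i \<eta> = basis (i, \<eta>)"

definition incl :: "'m Vplus \<Rightarrow> 'm H" where
  "incl = lin_ext (\<lambda>x. basis (Poly_Mapping.single x 1))"

definition mult :: "'m HH \<Rightarrow> 'm H" where
  "mult = lin_ext (\<lambda>(p, q). basis p * basis q)"

definition theta :: "'m letter \<Rightarrow> 'm Vplus \<Rightarrow> 'm Vplus" where
  "theta k = lin_ext (\<lambda>(i, \<eta>). coord i (k # \<eta>))"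

definition monom_fun :: "'m::finite monom \<Rightarrow> 'm series \<Rightarrow> real" where
  "monom_fun p c = (\<Prod>(i, \<eta>)\<in>Poly_Mapping.keys p. component c i \<eta> ^ Poly_Mapping.lookup p (i, \<eta>))"

definition fun_HH :: "'m::finite HH \<Rightarrow> 'm series \<Rightarrow> 'm series \<Rightarrow> real" where
  "fun_HH t c d = lin_ext (\<lambda>(p, q). monom_fun p c * monom_fun q d) t"

definition unital_alg_hom :: "('a::{real_vector, ring_1} \<Rightarrow> 'b::{real_vector, ring_1}) \<Rightarrow> bool" where
  "unital_alg_hom F \<longleftrightarrow> linear F \<and> F 1 = 1 \<and> (\<forall>p q. F (p * q) = F p * F q)"

definition is_coproduct :: "('m::finite H \<Rightarrow> 'm HH) \<Rightarrow> bool" where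
  "is_coproduct \<Delta> \<longleftrightarrow> unital_alg_hom \<Delta> \<and>
     (\<forall>i \<eta> c d. fun_HH (\<Delta> (incl (coord i \<eta>))) c d = component (feedback_prod c d) i \<eta>)"

text \<open>The counit is the constant coefficient: it kills every \<open>a\<^sup>i\<^sub>\<eta>\<close> and maps \<open>1\<close> to \<open>1\<close>.\<close>

definition counit :: "'m H \<Rightarrow> real" where
  "counit p = Poly_Mapping.lookup p 0"

definition is_antipode :: "('m H \<Rightarrow> 'm HH) \<Rightarrow> ('m H \<Rightarrow> 'm H) \<Rightarrow> bool" where
  "is_antipode \<Delta> S \<longleftrightarrow> linear S \<and>
     (\<forall>p. mult (tensor_map S id (\<Delta> p)) = counit p *\<^sub>R 1) \<and>
     (\<forall>p. mult (tensor_map id S (\<Delta> p)) = counit p *\<^sub>R 1)"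

definition shuffle_coproduct_rec :: "('m \<Rightarrow> 'm Vplus \<Rightarrow> 'm VV) \<Rightarrow> bool" where
  "shuffle_coproduct_rec Dsh \<longleftrightarrow>
     (\<forall>j. linear (Dsh j)) \<and>
     (\<forall>j i. Dsh j (coord i []) = tensor (coord i []) (coord j [])) \<and>
     (\<forall>j k. Dsh j \<circ> theta k =
        (\<lambda>t. tensor_map (theta k) id t + tensor_map id (theta k) t) \<circ> Dsh j)"

text \<open>
  In the recursion for \<open>\<theta>\<^sub>0\<close> the second factor of \<open>\<Delta>\<^sup>l v \<in> V\<^sub>+ \<otimes> V\<^sub>+\<close> is regarded as an element of \<open>H\<close>
  by means of \<^const>\<open>incl\<close>.
\<close>

definition red_coproduct_rec ::
  "('m::finite \<Rightarrow> 'm Vplus \<Rightarrow> 'm VV) \<Rightarrow> ('m Vplus \<Rightarrow> 'm VH) \<Rightarrow> bool" where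
  "red_coproduct_rec Dsh T \<longleftrightarrow>
     linear T \<and>
     (\<forall>i. T (coord i []) = tensor (coord i []) 1) \<and>
     (\<forall>l. T \<circ> theta (Some l) = tensor_map (theta (Some l)) id \<circ> T) \<and>
     (T \<circ> theta None = (\<lambda>v. tensor_map (theta None) id (T v) +
        (\<Sum>l\<in>UNIV. (tensor_map (theta (Some l)) mult \<circ> tensor_assoc \<circ> tensor_map T incl \<circ> Dsh l) v)))"

definition red_coproduct' :: "('m Vplus \<Rightarrow> 'm VH) \<Rightarrow> 'm Vplus \<Rightarrow> 'm VH" where
  "red_coproduct' T v = T v - tensor v 1"

text \<open>
  The left recursion only involves the values of the antipode on \<open>V\<^sub>+\<close>, the right one also those
  on products of coordinate maps.
\<close>

definition antipode_left_rec :: "('m Vplus \<Rightarrow> 'm VH) \<Rightarrow> ('m Vplus \<Rightarrow> 'm H) \<Rightarrow> bool" where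
  "antipode_left_rec T R \<longleftrightarrow> (\<forall>i \<eta>. R (coord i \<eta>) =
     - incl (coord i \<eta>) - mult (tensor_map R id (red_coproduct' T (coord i \<eta>))))"

definition antipode_right_rec :: "('m Vplus \<Rightarrow> 'm VH) \<Rightarrow> ('m H \<Rightarrow> 'm H) \<Rightarrow> bool" where
  "antipode_right_rec T R \<longleftrightarrow> (\<forall>i \<eta>. R (incl (coord i \<eta>)) =
     - incl (coord i \<eta>) - mult (tensor_map incl R (red_coproduct' T (coord i \<eta>))))"

end

theory Submission
  imports Defs
begin

text \<open>
  Evaluated at series, the recursions for \<open>\<Delta>\<^sup>j\<close> (shuffle) and \<open>\<Delta>~\<close> say how a left shift by a letter acts on a shuffle
  product, on which it is a derivation, and on a modified composition \<open>c \<circ>~ d\<close>. Polynomial functions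
  determine their polynomials, so \<open>\<Delta>~ a = \<Delta> a - 1 \<otimes> a\<close>. For the antipode, \<open>\<Delta>' a\<close> only involves factors of
  smaller degree than \<open>a\<close>; so the left recursion has one solution. An algebra homomorphism \<open>R\<close>
  satisfying the right recursion on the generators is a right convolution inverse of the identity on all
  of \<open>H\<close>, because \<open>H\<close> is commutative; and by induction on the degree there is only one such inverse.
\<close>

text \<open>The obstacle is the rule for \<open>theta None\<close>: it applies the map being defined
  again to the first factors of a shuffle coproduct, whose words are subsequences but not tails of
  the given word. Structural recursion is thus replaced by recursion on weight. A shuffle coproduct
  distributes the letters of a word over two words, so total weight is preserved. Counting
  \<open>x_0\<close> twice then gives a strict degree bound as well, since the rule trades an
  \<open>x_0\<close> for some \<open>x_l\<close> in the first factor. The two antipode recursions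
  differ in the factor that carries the unknown map. On the left it is a coordinate map, so
  linearity suffices for uniqueness. On the right it is a monomial, and the recursion says nothing
  about values on products; multiplicativity of the solution has to fill this gap.\<close>

instance poly_mapping :: (monoid_add, real_algebra_1) real_algebra_1
proof
  fix r :: real and p q :: "'a \<Rightarrow>\<^sub>0 'b"
  \<comment> \<open>Scaling as multiplication by a constant turns both compatibility laws into
    associativity and centrality of constants.\<close>
  have scale: "r *\<^sub>R p = Poly_Mapping.single 0 (r *\<^sub>R 1) * p" for p :: "'a \<Rightarrow>\<^sub>0 'b"
  proof -
    have "Poly_Mapping.map ((*) (r *\<^sub>R 1)) p = r *\<^sub>R p"
      by (rule poly_mapping_eqI) (simp add: lookup_scaleR map.rep_eq when_def)
    then show ?thesis
      using mult_map_scale_conv_mult[of "r *\<^sub>R 1" p] by simp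
  qed
  show "r *\<^sub>R p * q = r *\<^sub>R (p * q)"
    by (simp add: scale mult.assoc)
  \<comment> \<open>The key 0 is neutral and \<open>r *\<^sub>R 1\<close> is central among the
    coefficients, so singletons commute with the constant; the induction adds them one at a
    time.\<close>
  have "p * Poly_Mapping.single 0 (r *\<^sub>R 1) = Poly_Mapping.single 0 (r *\<^sub>R 1) * p"
  proof (induction p rule: Poly_Mapping.update_induct)
    case (update f k b)
    have "Poly_Mapping.update k b f = f + Poly_Mapping.single k b"
      by (rule poly_mapping_eqI)
        (use update in \<open>auto simp: Poly_Mapping.lookup_update lookup_add lookup_single when_def in_keys_iff\<close>)
    with update show ?case
      by (simp add: distrib_left distrib_right mult_single)
  qed simp
  then show "p * r *\<^sub>R q = r *\<^sub>R (p * q)"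
    by (simp add: scale mult.assoc [symmetric])
qed

section \<open>Linear extension from a basis\<close>

lemma lin_ext_superset:
  assumes "finite A" "Poly_Mapping.keys p \<subseteq> A"
  shows "lin_ext f p = (\<Sum>x\<in>A. Poly_Mapping.lookup p x *\<^sub>R f x)"
  unfolding lin_ext_def
  by (rule sum.mono_neutral_left) (use assms in \<open>auto simp: in_keys_iff\<close>)

lemma linear_lin_ext: "linear (lin_ext f)"
proof (rule linearI)
  fix p q :: "'a \<Rightarrow>\<^sub>0 real" and r :: real
  let ?A = "Poly_Mapping.keys p \<union> Poly_Mapping.keys q"
  have sub: "Poly_Mapping.keys (p + q) \<subseteq> ?A" by (rule keys_add)
  show "lin_ext f (p + q) = lin_ext f p + lin_ext f q"
    by (simp add: lin_ext_superset[of ?A] sub lookup_add scaleR_add_left sum.distrib)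
  have "Poly_Mapping.keys (r *\<^sub>R p) \<subseteq> Poly_Mapping.keys p"
    by (auto simp: in_keys_iff lookup_scaleR)
  then show "lin_ext f (r *\<^sub>R p) = r *\<^sub>R lin_ext f p"
    by (simp add: lin_ext_superset[of "Poly_Mapping.keys p"] lookup_scaleR scaleR_sum_right)
qed

lemma lin_ext_basis [simp]: "lin_ext f (basis x) = f x"
  by (simp add: lin_ext_def basis_def)

lemma lin_ext_basis_id: "lin_ext basis p = p"
proof (rule poly_mapping_eqI)
  fix k
  have "Poly_Mapping.lookup (lin_ext basis p) k =
      (\<Sum>x\<in>Poly_Mapping.keys p. if x = k then Poly_Mapping.lookup p x else 0)"
    unfolding lin_ext_def lookup_sum
    by (rule sum.cong) (auto simp: lookup_scaleR basis_def lookup_single when_def)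
  then show "Poly_Mapping.lookup (lin_ext basis p) k = Poly_Mapping.lookup p k"
    by (simp add: in_keys_iff)
qed

lemma lin_ext_comp:
  assumes "linear F"
  shows "F (lin_ext f p) = lin_ext (\<lambda>x. F (f x)) p"
  by (simp add: lin_ext_def linear_sum[OF assms] linear_scale[OF assms])

lemma linear_eq_lin_ext: "linear F \<Longrightarrow> F p = lin_ext (\<lambda>x. F (basis x)) p"
  using lin_ext_comp[of F basis p] by (simp add: lin_ext_basis_id)

lemma linear_eq_on_basis:
  assumes "linear F" "linear G" "\<And>x. F (basis x) = G (basis x)"
  shows "F p = G p"
  using linear_eq_lin_ext[of F p] linear_eq_lin_ext[of G p] assms by simp

text \<open>As a congruence rule for recursive definitions, it records that a recursive call under
  \<open>lin_ext\<close> is made only at keys of the argument; the termination proof of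
  \<open>red_cop\<close> and its induction rule depend on this.\<close>

lemma lin_ext_cong [fundef_cong]:
  assumes "p = q" "\<And>x. x \<in> Poly_Mapping.keys q \<Longrightarrow> f x = g x"
  shows "lin_ext f p = lin_ext g q"
  using assms by (simp add: lin_ext_def)

lemma keys_lin_extE:
  assumes "y \<in> Poly_Mapping.keys (lin_ext f p)"
  obtains x where "x \<in> Poly_Mapping.keys p" "y \<in> Poly_Mapping.keys (f x)"
proof -
  have "\<exists>x\<in>Poly_Mapping.keys p. Poly_Mapping.lookup (f x) y \<noteq> 0"
  proof (rule ccontr)
    assume "\<not> ?thesis"
    then have "Poly_Mapping.lookup (lin_ext f p) y = 0"
      by (simp add: lin_ext_def lookup_sum lookup_scaleR)
    with assms show False by (simp add: in_keys_iff)
  qed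
  then show thesis using that by (auto simp: in_keys_iff)
qed

lemma keys_basis [simp]: "Poly_Mapping.keys (basis x) = {x}"
  by (simp add: basis_def)

lemma basis_0: "basis 0 = 1"
  by (simp add: basis_def)

lemma basis_add: "basis (x + y) = basis x * basis y"
  by (simp add: basis_def mult_single)

lemma linear_mult_left: "linear (\<lambda>p. p * q)" for q :: "'a::real_algebra"
  by (simp add: linear_iff algebra_simps)

lemma linear_mult_right: "linear (\<lambda>q. p * q)" for p :: "'a::real_algebra"
  by (simp add: linear_iff algebra_simps)

lemma linear_comp: "linear F \<Longrightarrow> linear G \<Longrightarrow> linear (\<lambda>p. G (F p))"
  using linear_compose[of F G] by (simp add: comp_def)

section \<open>Tensor products\<close>

lemma linear_tensor_left: "linear (\<lambda>p. tensor p q)"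
  unfolding tensor_def by (rule linear_lin_ext)

lemma tensor_basis_left: "tensor (basis x) q = lin_ext (\<lambda>y. basis (x, y)) q"
  by (simp add: tensor_def)

text \<open>The definition of \<open>tensor\<close> nests the second argument inside the expansion
  of the first, so here the map is exhibited as a fixed linear combination of linear maps.\<close>

lemma linear_tensor_right: "linear (tensor p :: ('b \<Rightarrow>\<^sub>0 real) \<Rightarrow> _)"
proof -
  have "linear (\<lambda>q :: 'b \<Rightarrow>\<^sub>0 real. \<Sum>x\<in>Poly_Mapping.keys p. Poly_Mapping.lookup p x *\<^sub>R tensor (basis x) q)"
    by (intro linear_compose_sum ballI linear_compose_scale_right)
      (simp add: tensor_basis_left linear_lin_ext)
  moreover have "tensor p = (\<lambda>q :: 'b \<Rightarrow>\<^sub>0 real. \<Sum>x\<in>Poly_Mapping.keys p. Poly_Mapping.lookup p x *\<^sub>R tensor (basis x) q)"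
    unfolding tensor_basis_left by (simp add: tensor_def lin_ext_def fun_eq_iff)
  ultimately show ?thesis by (simp only:)
qed

lemma tensor_basis [simp]: "tensor (basis x) (basis y) = basis (x, y)"
  by (simp add: tensor_def)

lemma tensor_basis_one [simp]: "tensor (basis x) 1 = basis (x, 0)"
  unfolding basis_0[symmetric] by (rule tensor_basis)

lemma tensor_one_basis [simp]: "tensor 1 (basis y) = basis (0, y)"
  unfolding basis_0[symmetric] by (rule tensor_basis)

lemma bilinear_eq_on_basis:
  assumes "\<And>q. linear (\<lambda>p. F p q)" "\<And>p. linear (F p)" "\<And>q. linear (\<lambda>p. G p q)" "\<And>p. linear (G p)"
    and "\<And>x y. F (basis x) (basis y) = G (basis x) (basis y)"
  shows "F p q = G p q"
proof (rule linear_eq_on_basis[of "\<lambda>p. F p q" "\<lambda>p. G p q"])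
  show "F (basis x) q = G (basis x) q" for x
    by (rule linear_eq_on_basis) (use assms in auto)
qed (use assms in auto)

lemma linear_tensor_map: "linear (tensor_map F G)"
  unfolding tensor_map_def by (rule linear_lin_ext)

lemma tensor_map_basis [simp]: "tensor_map F G (basis (x, y)) = tensor (F (basis x)) (G (basis y))"
  by (simp add: tensor_map_def)

lemma tensor_map_tensor:
  assumes "linear F" "linear G"
  shows "tensor_map F G (tensor p q) = tensor (F p) (G q)"
proof (rule bilinear_eq_on_basis[where F = "\<lambda>p q. tensor_map F G (tensor p q)" and G = "\<lambda>p q. tensor (F p) (G q)"])
  show "linear (\<lambda>p. tensor_map F G (tensor p q))" for q
    by (rule linear_comp[OF linear_tensor_left linear_tensor_map])
  show "linear (\<lambda>q. tensor_map F G (tensor p q))" for p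
    by (rule linear_comp[OF linear_tensor_right linear_tensor_map])
  show "linear (\<lambda>p. tensor (F p) (G q))" for q
    by (rule linear_comp[OF assms(1) linear_tensor_left])
  show "linear (\<lambda>q. tensor (F p) (G q))" for p
    by (rule linear_comp[OF assms(2) linear_tensor_right])
qed simp

lemma linear_mult: "linear mult"
  unfolding mult_def by (rule linear_lin_ext)

lemma mult_basis [simp]: "mult (basis (p, q)) = basis p * basis q"
  by (simp add: mult_def)

lemma mult_tensor: "mult (tensor p q) = p * q"
proof (rule bilinear_eq_on_basis[where F = "\<lambda>p q. mult (tensor p q)" and G = "(*)"])
  show "linear (\<lambda>p. mult (tensor p q))" for q
    by (rule linear_comp[OF linear_tensor_left linear_mult])
  show "linear (\<lambda>q. mult (tensor p q))" for p
    by (rule linear_comp[OF linear_tensor_right linear_mult])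
qed (auto simp: linear_mult_left linear_mult_right)

lemma multiplicative_on_basis:
  fixes F :: "('a::monoid_add \<Rightarrow>\<^sub>0 real) \<Rightarrow> 'b::real_algebra"
  assumes "linear F" "\<And>x y. F (basis (x + y)) = F (basis x) * F (basis y)"
  shows "F (p * q) = F p * F q"
proof (rule bilinear_eq_on_basis[where F = "\<lambda>p q. F (p * q)" and G = "\<lambda>p q. F p * F q"])
  show "linear (\<lambda>p. F (p * q))" for q
    by (rule linear_comp[OF linear_mult_left assms(1)])
  show "linear (\<lambda>q. F (p * q))" for p
    by (rule linear_comp[OF linear_mult_right assms(1)])
  show "linear (\<lambda>p. F p * F q)" for q
    by (rule linear_comp[OF assms(1) linear_mult_left])
  show "linear (\<lambda>q. F p * F q)" for p
    by (rule linear_comp[OF assms(1) linear_mult_right])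
qed (simp add: assms(2) basis_add[symmetric])

lemma keys_tensorD:
  "(x, y) \<in> Poly_Mapping.keys (tensor p q) \<Longrightarrow> x \<in> Poly_Mapping.keys p \<and> y \<in> Poly_Mapping.keys q"
  unfolding tensor_def by (auto elim!: keys_lin_extE)

section \<open>Left shifts of shuffle products and modified compositions\<close>

text \<open>This is the transpose of \<open>theta x\<close>: a coordinate functional composed with
  \<open>theta x\<close> at \<open>c\<close> is the original functional at
  \<open>shift x c\<close>.\<close>

definition shift :: "'m letter \<Rightarrow> ('m word \<Rightarrow> 'b) \<Rightarrow> 'm word \<Rightarrow> 'b" where
  "shift x c = (\<lambda>\<eta>. c (x # \<eta>))"

lemma sum_words_Cons:
  fixes f :: "'m::finite word \<Rightarrow> 'b::comm_monoid_add"
  shows "(\<Sum>\<eta> | length \<eta> \<le> Suc n. f \<eta>) = f [] + (\<Sum>x\<in>UNIV. \<Sum>\<eta> | length \<eta> \<le> n. f (x # \<eta>))"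
proof -
  have eq: "{\<eta> :: 'm word. length \<eta> \<le> Suc n} =
      insert [] ((\<lambda>(x, \<eta>). x # \<eta>) ` (UNIV \<times> {\<eta>. length \<eta> \<le> n}))"
  proof (rule set_eqI)
    fix \<eta> :: "'m word"
    show "\<eta> \<in> {\<eta>. length \<eta> \<le> Suc n} \<longleftrightarrow>
        \<eta> \<in> insert [] ((\<lambda>(x, \<eta>). x # \<eta>) ` (UNIV \<times> {\<eta>. length \<eta> \<le> n}))"
      by (cases \<eta>) auto
  qed
  have "(\<Sum>\<eta> | length \<eta> \<le> Suc n. f \<eta>) =
      f [] + sum f ((\<lambda>(x, \<eta>). x # \<eta>) ` (UNIV \<times> {\<eta> :: 'm word. length \<eta> \<le> n}))"
    unfolding eq by (rule sum.insert) (auto simp: finite_words_le)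
  also have "sum f ((\<lambda>(x, \<eta>). x # \<eta>) ` (UNIV \<times> {\<eta> :: 'm word. length \<eta> \<le> n})) =
      (\<Sum>x\<in>UNIV. \<Sum>\<eta> | length \<eta> \<le> n. f (x # \<eta>))"
    by (subst sum.reindex) (auto simp: inj_on_def sum.cartesian_product case_prod_unfold)
  finally show ?thesis .
qed

text \<open>Lengths add up in a shuffle, so long words do not contribute. The bound \<open>n\<close>
  stays free in order that coefficients at words of different lengths can be compared over one index
  set.\<close>

lemma shuffle_eq_sum:
  fixes c d :: "'m::finite scalar_series"
  assumes "length \<nu> \<le> n"
  shows "shuffle c d \<nu> = (\<Sum>\<xi> | length \<xi> \<le> n. \<Sum>\<zeta> | length \<zeta> \<le> n. c \<xi> * d \<zeta> * word_shuffle \<xi> \<zeta> \<nu>)"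
proof -
  let ?W = "{\<eta> :: 'm word. length \<eta> \<le> n}"
  have "shuffle c d \<nu> = (\<Sum>(\<xi>, \<zeta>)\<in>?W \<times> ?W. c \<xi> * d \<zeta> * word_shuffle \<xi> \<zeta> \<nu>)"
    unfolding shuffle_def
  proof (rule Sum_any.expand_superset)
    show "finite (?W \<times> ?W)" by (simp add: finite_words_le)
    show "{p. (case p of (\<xi>, \<zeta>) \<Rightarrow> c \<xi> * d \<zeta> * word_shuffle \<xi> \<zeta> \<nu>) \<noteq> 0} \<subseteq> ?W \<times> ?W"
      using assms by (auto dest!: word_shuffle_length)
  qed
  then show ?thesis by (simp add: sum.cartesian_product)
qed

lemma word_shuffle_Nil_right: "word_shuffle \<xi> [] = (\<lambda>\<nu>. if \<nu> = \<xi> then 1 else 0)"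
  by (cases \<xi>) auto

lemma word_shuffle_Cons:
  "word_shuffle \<xi> \<zeta> (x # \<nu>) =
     (case \<xi> of [] \<Rightarrow> 0 | y # \<xi>' \<Rightarrow> if y = x then word_shuffle \<xi>' \<zeta> \<nu> else 0) +
     (case \<zeta> of [] \<Rightarrow> 0 | y # \<zeta>' \<Rightarrow> if y = x then word_shuffle \<xi> \<zeta>' \<nu> else 0)"
  by (cases \<xi>; cases \<zeta>) (auto simp: word_shuffle_Nil_right)

lemma shuffle_Nil: "shuffle c d [] = c [] * d []" for c d :: "'m::finite scalar_series"
proof -
  have "{\<eta> :: 'm word. length \<eta> \<le> 0} = {[]}" by auto
  then show ?thesis by (simp add: shuffle_eq_sum[of "[]" 0])
qed

text \<open>The first letter of a shuffled word comes from one of the two factors; \<open>?A\<close>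
  and \<open>?B\<close> collect the two possibilities. In each, splitting off the first letter of
  the relevant factor leaves only the words that begin with \<open>x\<close>.\<close>

lemma shuffle_Cons:
  fixes c d :: "'m::finite scalar_series"
  shows "shuffle c d (x # \<nu>) = shuffle (shift x c) d \<nu> + shuffle c (shift x d) \<nu>"
proof -
  let ?W = "\<lambda>n. {\<eta> :: 'm word. length \<eta> \<le> n}"
  let ?n = "length \<nu>"
  have fin: "finite (?W n)" for n by (rule finite_words_le)
  have sub: "?W ?n \<subseteq> ?W (Suc ?n)" by auto
  have "shuffle c d (x # \<nu>) = (\<Sum>\<xi>\<in>?W (Suc ?n). \<Sum>\<zeta>\<in>?W (Suc ?n). c \<xi> * d \<zeta> *
        (case \<xi> of [] \<Rightarrow> 0 | y # \<xi>' \<Rightarrow> if y = x then word_shuffle \<xi>' \<zeta> \<nu> else 0)) +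
      (\<Sum>\<zeta>\<in>?W (Suc ?n). \<Sum>\<xi>\<in>?W (Suc ?n). c \<xi> * d \<zeta> *
        (case \<zeta> of [] \<Rightarrow> 0 | y # \<zeta>' \<Rightarrow> if y = x then word_shuffle \<xi> \<zeta>' \<nu> else 0))"
    (is "_ = ?A + ?B")
    by (subst (2) sum.swap) (simp add: shuffle_eq_sum[of _ "Suc ?n"] word_shuffle_Cons
        distrib_left sum.distrib)
  also have "?A = (\<Sum>y\<in>UNIV. \<Sum>\<xi>\<in>?W ?n. \<Sum>\<zeta>\<in>?W (Suc ?n). c (y # \<xi>) * d \<zeta> *
      (if y = x then word_shuffle \<xi> \<zeta> \<nu> else 0))"
    by (subst (1) sum_words_Cons) simp
  also have "\<dots> = (\<Sum>y\<in>UNIV. if y = x then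
      \<Sum>\<xi>\<in>?W ?n. \<Sum>\<zeta>\<in>?W (Suc ?n). c (y # \<xi>) * d \<zeta> * word_shuffle \<xi> \<zeta> \<nu> else 0)"
    by (rule sum.cong) auto
  also have "\<dots> = (\<Sum>\<xi>\<in>?W ?n. \<Sum>\<zeta>\<in>?W (Suc ?n). c (x # \<xi>) * d \<zeta> * word_shuffle \<xi> \<zeta> \<nu>)"
    by simp
  \<comment> \<open>The words added to the index set are longer than \<open>\<nu>\<close>, hence
    contribute nothing to its coefficient.\<close>
  also have "\<dots> = (\<Sum>\<xi>\<in>?W (Suc ?n). \<Sum>\<zeta>\<in>?W (Suc ?n). c (x # \<xi>) * d \<zeta> * word_shuffle \<xi> \<zeta> \<nu>)"
    by (rule sum.mono_neutral_left[OF fin sub])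
      (auto intro!: sum.neutral dest!: word_shuffle_length)
  also have "\<dots> = shuffle (shift x c) d \<nu>"
    by (simp add: shuffle_eq_sum[of _ "Suc ?n"] shift_def)
  also have "?B = (\<Sum>y\<in>UNIV. \<Sum>\<zeta>\<in>?W ?n. \<Sum>\<xi>\<in>?W (Suc ?n). c \<xi> * d (y # \<zeta>) *
      (if y = x then word_shuffle \<xi> \<zeta> \<nu> else 0))"
    by (subst (1) sum_words_Cons) simp
  also have "\<dots> = (\<Sum>y\<in>UNIV. if y = x then
      \<Sum>\<zeta>\<in>?W ?n. \<Sum>\<xi>\<in>?W (Suc ?n). c \<xi> * d (y # \<zeta>) * word_shuffle \<xi> \<zeta> \<nu> else 0)"
    by (rule sum.cong) auto
  also have "\<dots> = (\<Sum>\<zeta>\<in>?W ?n. \<Sum>\<xi>\<in>?W (Suc ?n). c \<xi> * d (x # \<zeta>) * word_shuffle \<xi> \<zeta> \<nu>)"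
    by simp
  also have "\<dots> = (\<Sum>\<zeta>\<in>?W (Suc ?n). \<Sum>\<xi>\<in>?W (Suc ?n). c \<xi> * d (x # \<zeta>) * word_shuffle \<xi> \<zeta> \<nu>)"
    by (rule sum.mono_neutral_left[OF fin sub])
      (auto intro!: sum.neutral dest!: word_shuffle_length)
  also have "\<dots> = shuffle c (shift x d) \<nu>"
    by (subst sum.swap) (simp add: shuffle_eq_sum[of _ "Suc ?n"] shift_def)
  finally show ?thesis .
qed

lemma shuffle_cong:
  fixes c d :: "'m::finite scalar_series"
  assumes "\<And>\<zeta>. length \<zeta> \<le> length \<nu> \<Longrightarrow> d \<zeta> = d' \<zeta>"
  shows "shuffle c d \<nu> = shuffle c d' \<nu>"
  by (simp add: shuffle_eq_sum[OF order_refl] assms)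

lemma shuffle_sum_right:
  fixes c :: "'m::finite scalar_series"
  shows "shuffle c (\<lambda>\<zeta>. \<Sum>k\<in>K. a k * f k \<zeta>) \<nu> = (\<Sum>k\<in>K. a k * shuffle c (f k) \<nu>)"
proof -
  let ?W = "{\<eta> :: 'm word. length \<eta> \<le> length \<nu>}"
  have "shuffle c (\<lambda>\<zeta>. \<Sum>k\<in>K. a k * f k \<zeta>) \<nu> =
      (\<Sum>\<xi>\<in>?W. \<Sum>\<zeta>\<in>?W. \<Sum>k\<in>K. a k * (c \<xi> * f k \<zeta> * word_shuffle \<xi> \<zeta> \<nu>))"
    by (simp add: shuffle_eq_sum[OF order_refl] sum_distrib_left sum_distrib_right mult_ac)
  also have "\<dots> = (\<Sum>k\<in>K. \<Sum>\<xi>\<in>?W. \<Sum>\<zeta>\<in>?W. a k * (c \<xi> * f k \<zeta> * word_shuffle \<xi> \<zeta> \<nu>))"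
    by (subst (2) sum.swap, subst sum.swap) (rule refl)
  finally show ?thesis
    by (simp add: shuffle_eq_sum[OF order_refl] sum_distrib_left)
qed

lemma shuffle_zero_left: "shuffle (\<lambda>_. 0) d \<nu> = 0"
  by (simp add: shuffle_def)

lemma component_modified_comp:
  fixes c d :: "'m::finite series"
  assumes "length \<nu> \<le> n"
  shows "component (modified_comp c d) i \<nu> =
    (\<Sum>\<eta> | length \<eta> \<le> n. component c i \<eta> * phi d \<eta> one_series \<nu>)"
proof -
  have "modified_comp c d \<nu> = (\<Sum>\<eta> | length \<eta> \<le> n. phi d \<eta> one_series \<nu> *\<^sub>R c \<eta>)"
    unfolding modified_comp_def
  proof (rule Sum_any.expand_superset[OF finite_words_le])
    show "{\<eta>. phi d \<eta> one_series \<nu> *\<^sub>R c \<eta> \<noteq> 0} \<subseteq> {\<eta>. length \<eta> \<le> n}"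
      using phi_order[of \<nu> _ d] assms by (force simp: not_le)
  qed
  then show ?thesis by (simp add: component_def mult.commute)
qed

lemma component_modified_comp_Nil: "component (modified_comp c d) i [] = component c i []"
  for c d :: "'m::finite series"
proof -
  have "{\<eta> :: 'm word. length \<eta> \<le> 0} = {[]}" by auto
  then show ?thesis by (simp add: component_modified_comp[of "[]" 0] one_series_def)
qed

text \<open>\<open>phi_letter d x\<close> prefixes either \<open>x\<close> itself or, after
  shuffling with the component of \<open>d\<close> for \<open>x\<close>, the letter
  \<open>None\<close>. Removing a leading \<open>Some l\<close> therefore meets only words of
  \<open>c\<close> that begin with this letter, whereas removing \<open>None\<close> meets every
  first letter.\<close>

lemma component_modified_comp_Cons:
  fixes c d :: "'m::finite series"
  shows "component (modified_comp c d) i (y # \<nu>) = component (modified_comp (shift y c) d) i \<nu> +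
    (if y = None then \<Sum>l\<in>UNIV. shuffle (component d l) (component (modified_comp (shift (Some l) c) d) i) \<nu>
     else 0)"
proof -
  let ?W = "{\<eta> :: 'm word. length \<eta> \<le> length \<nu>}"
  let ?D = "\<lambda>x. case x of None \<Rightarrow> (\<lambda>_. 0) | Some l \<Rightarrow> component d l"
  have "component (modified_comp c d) i (y # \<nu>) =
      (\<Sum>x\<in>UNIV. \<Sum>\<eta>\<in>?W. component c i (x # \<eta>) * phi_letter d x (phi d \<eta> one_series) (y # \<nu>))"
    by (simp add: component_modified_comp[of "y # \<nu>" "Suc (length \<nu>)"] sum_words_Cons one_series_def)
  also have "\<dots> = (\<Sum>x\<in>UNIV. (if x = y then \<Sum>\<eta>\<in>?W. component c i (x # \<eta>) * phi d \<eta> one_series \<nu> else 0) +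
      (if y = None then \<Sum>\<eta>\<in>?W. component c i (x # \<eta>) * shuffle (?D x) (phi d \<eta> one_series) \<nu> else 0))"
    by (rule sum.cong) (auto simp: phi_letter_def distrib_left sum.distrib)
  also have "\<dots> = (\<Sum>\<eta>\<in>?W. component c i (y # \<eta>) * phi d \<eta> one_series \<nu>) +
      (if y = None then
        \<Sum>x\<in>UNIV. \<Sum>\<eta>\<in>?W. component c i (x # \<eta>) * shuffle (?D x) (phi d \<eta> one_series) \<nu> else 0)"
    by (cases y) (simp_all add: sum.distrib)
  also have "(\<Sum>\<eta>\<in>?W. component c i (y # \<eta>) * phi d \<eta> one_series \<nu>) =
      component (modified_comp (shift y c) d) i \<nu>"
    unfolding component_modified_comp[OF order_refl] by (simp add: component_def shift_def)
  also have "(\<Sum>x\<in>UNIV. \<Sum>\<eta>\<in>?W. component c i (x # \<eta>) * shuffle (?D x) (phi d \<eta> one_series) \<nu>) =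
      (\<Sum>x\<in>UNIV. shuffle (?D x) (component (modified_comp (shift x c) d) i) \<nu>)"
  proof (rule sum.cong[OF refl])
    fix x
    \<comment> \<open>Linearity of the shuffle is available for finite sums. Its coefficient at
      \<open>\<nu>\<close> reads only words no longer than \<open>\<nu>\<close>, and for all of
      these the same truncation of the composition is exact.\<close>
    have "shuffle (?D x) (component (modified_comp (shift x c) d) i) \<nu> =
        shuffle (?D x) (\<lambda>\<zeta>. \<Sum>\<eta>\<in>?W. component c i (x # \<eta>) * phi d \<eta> one_series \<zeta>) \<nu>"
    proof (rule shuffle_cong)
      fix \<zeta> :: "'m word"
      assume "length \<zeta> \<le> length \<nu>"
      from component_modified_comp[OF this, of "shift x c" d i]
      show "component (modified_comp (shift x c) d) i \<zeta> =
          (\<Sum>\<eta>\<in>?W. component c i (x # \<eta>) * phi d \<eta> one_series \<zeta>)"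
        by (simp add: component_def shift_def)
    qed
    then show "(\<Sum>\<eta>\<in>?W. component c i (x # \<eta>) * shuffle (?D x) (phi d \<eta> one_series) \<nu>) =
        shuffle (?D x) (component (modified_comp (shift x c) d) i) \<nu>"
      by (simp add: shuffle_sum_right)
  qed
  also have "\<dots> = (\<Sum>l\<in>UNIV. shuffle (component d l) (component (modified_comp (shift (Some l) c) d) i) \<nu>)"
    by (simp add: UNIV_option_conv sum.reindex shuffle_zero_left)
  finally show ?thesis .
qed

section \<open>Separation of polynomials by their values\<close>

definition coord_value :: "'m::finite series \<Rightarrow> 'm coord \<Rightarrow> real" where
  "coord_value c = (\<lambda>(i, \<eta>). component c i \<eta>)"

lemma monom_fun_superset:
  assumes "finite A" "Poly_Mapping.keys p \<subseteq> A"
  shows "monom_fun p c = (\<Prod>x\<in>A. coord_value c x ^ Poly_Mapping.lookup p x)"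
proof -
  have "monom_fun p c = (\<Prod>x\<in>Poly_Mapping.keys p. coord_value c x ^ Poly_Mapping.lookup p x)"
    unfolding monom_fun_def coord_value_def by (rule prod.cong) auto
  also have "\<dots> = (\<Prod>x\<in>A. coord_value c x ^ Poly_Mapping.lookup p x)"
    by (rule prod.mono_neutral_left) (use assms in \<open>auto simp: in_keys_iff\<close>)
  finally show ?thesis .
qed

lemma monom_fun_0: "monom_fun 0 c = 1"
  by (simp add: monom_fun_def)

lemma monom_fun_add: "monom_fun (p + q) c = monom_fun p c * monom_fun q c"
proof -
  let ?A = "Poly_Mapping.keys p \<union> Poly_Mapping.keys q"
  have sub: "Poly_Mapping.keys (p + q) \<subseteq> ?A" by (rule keys_add)
  show ?thesis
    by (simp add: monom_fun_superset[of ?A] sub lookup_add power_add prod.distrib)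
qed

lemma monom_fun_single: "monom_fun (Poly_Mapping.single x (Suc 0)) c = coord_value c x"
  by (subst monom_fun_superset[of "{x}"]) auto

lemma monom_fun_times:
  assumes "\<And>x. coord_value e x = coord_value c x * coord_value d x"
  shows "monom_fun p e = monom_fun p c * monom_fun p d"
  by (simp add: monom_fun_superset[OF finite_keys order_refl] assms power_mult_distrib prod.distrib)

lemma monom_fun_one:
  assumes "\<And>x. coord_value c x = 1"
  shows "monom_fun p c = 1"
  by (simp add: monom_fun_superset[OF finite_keys order_refl] assms)

text \<open>Such a series probes a single exponent: all other coordinates contribute the factor 1,
  and distinct powers of 2 are distinct.\<close>

lemma monom_fun_delta:
  assumes "\<And>y. coord_value c y = (if y = x then 2 else 1)"
  shows "monom_fun p c = 2 ^ Poly_Mapping.lookup p x"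
proof -
  have "monom_fun p c = (\<Prod>y\<in>insert x (Poly_Mapping.keys p). coord_value c y ^ Poly_Mapping.lookup p y)"
    by (rule monom_fun_superset) auto
  also have "\<dots> = (\<Prod>y\<in>insert x (Poly_Mapping.keys p). if y = x then 2 ^ Poly_Mapping.lookup p x else 1)"
    by (rule prod.cong) (auto simp: assms)
  finally show ?thesis by (simp add: prod.delta)
qed

text \<open>This is Dedekind's argument. Taking the relation at \<open>g x y\<close> and subtracting
  \<open>\<psi> l y\<close> times the relation at \<open>x\<close> eliminates the character
  \<open>l\<close>. The shorter relation has coefficients
  \<open>a k * (\<psi> k y - \<psi> l y)\<close>, and for each \<open>k\<close> some
  \<open>y\<close> makes the second factor nonzero.\<close>

lemma characters_independent:
  fixes \<psi> :: "'k \<Rightarrow> 'a \<Rightarrow> real"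
  assumes mult: "\<And>k x y. \<psi> k (g x y) = \<psi> k x * \<psi> k y"
    and one: "\<And>k. \<psi> k e = 1"
    and distinct: "\<And>k l. k \<noteq> l \<Longrightarrow> \<exists>x. \<psi> k x \<noteq> \<psi> l x"
    and "finite K"
    and "\<And>x. (\<Sum>k\<in>K. a k * \<psi> k x) = 0"
  shows "\<forall>k\<in>K. a k = 0"
  using assms(4,5)
proof (induction K arbitrary: a rule: finite_induct)
  case (insert l K)
  have "\<forall>k\<in>K. a k * (\<psi> k y - \<psi> l y) = 0" for y
  proof (rule insert.IH)
    fix x
    have "(\<Sum>k\<in>K. a k * (\<psi> k y - \<psi> l y) * \<psi> k x) =
        (\<Sum>k\<in>insert l K. a k * \<psi> k (g x y)) - \<psi> l y * (\<Sum>k\<in>insert l K. a k * \<psi> k x)"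
      using insert.hyps by (simp add: mult algebra_simps sum_subtractf sum_distrib_left)
    then show "(\<Sum>k\<in>K. a k * (\<psi> k y - \<psi> l y) * \<psi> k x) = 0"
      by (simp only: insert.prems)
  qed
  then have "\<forall>k\<in>K. a k = 0"
    using distinct insert.hyps(2) by (metis eq_iff_diff_eq_0 mult_eq_0_iff)
  moreover from this have "a l = 0"
    using insert.prems[of e] insert.hyps by (simp add: one)
  ultimately show ?case by simp
qed simp

text \<open>
  The products of two monomials are pairwise distinct characters of the multiplicative monoid of pairs of series.
\<close>

lemma fun_HH_eq_0D:
  fixes t :: "'m::finite HH"
  assumes "\<And>c d. fun_HH t c d = 0"
  shows "t = 0"
proof -
  let ?\<psi> = "\<lambda>(p, q) (c, d). monom_fun p c * monom_fun q d :: real"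
  define one :: "'m series" where "one = (\<lambda>_. \<chi> i. 1)"
  define delta :: "'m coord \<Rightarrow> 'm series"
    where "delta x = (\<lambda>\<eta>. \<chi> i. if (i, \<eta>) = x then 2 else 1)" for x
  define times :: "'m series \<Rightarrow> 'm series \<Rightarrow> 'm series"
    where "times c d = (\<lambda>\<eta>. \<chi> i. c \<eta> $ i * d \<eta> $ i)" for c d
  have one: "monom_fun p one = 1" for p
    by (rule monom_fun_one) (simp add: coord_value_def component_def one_def split: prod.split)
  have delta: "monom_fun p (delta x) = 2 ^ Poly_Mapping.lookup p x" for p x
    by (rule monom_fun_delta) (simp add: coord_value_def component_def delta_def split: prod.split)
  have times: "monom_fun p (times c d) = monom_fun p c * monom_fun p d" for p c d
    by (rule monom_fun_times) (simp add: coord_value_def component_def times_def split: prod.split)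
  have "\<forall>k\<in>Poly_Mapping.keys t. Poly_Mapping.lookup t k = 0"
  proof (rule characters_independent[of ?\<psi> "\<lambda>(c, d) (c', d'). (times c c', times d d')" "(one, one)"])
    fix k l :: "'m monom \<times> 'm monom"
    assume "k \<noteq> l"
    obtain p q p' q' where kl: "k = (p, q)" "l = (p', q')" by (cases k, cases l)
    have "\<exists>x. Poly_Mapping.lookup p x \<noteq> Poly_Mapping.lookup p' x \<or> Poly_Mapping.lookup q x \<noteq> Poly_Mapping.lookup q' x"
      using \<open>k \<noteq> l\<close> kl by (auto simp: poly_mapping_eq_iff fun_eq_iff)
    then obtain x where "Poly_Mapping.lookup p x \<noteq> Poly_Mapping.lookup p' x \<or> Poly_Mapping.lookup q x \<noteq> Poly_Mapping.lookup q' x" ..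
    \<comment> \<open>Probing one argument with \<open>delta x\<close> while the other is
      \<open>one\<close> isolates the exponent of \<open>x\<close> in a single tensor
      factor.\<close>
    then have "?\<psi> k (delta x, one) \<noteq> ?\<psi> l (delta x, one) \<or> ?\<psi> k (one, delta x) \<noteq> ?\<psi> l (one, delta x)"
      by (simp add: kl one delta)
    then show "\<exists>x. ?\<psi> k x \<noteq> ?\<psi> l x" by blast
  next
    fix x :: "'m series \<times> 'm series"
    show "(\<Sum>k\<in>Poly_Mapping.keys t. Poly_Mapping.lookup t k * ?\<psi> k x) = 0"
      using assms[of "fst x" "snd x"] by (simp add: fun_HH_def lin_ext_def case_prod_unfold)
  qed (auto simp: one times)
  then show ?thesis by (auto intro!: poly_mapping_eqI simp: in_keys_iff)
qed

section \<open>Recursive solutions for the two coproducts\<close>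

text \<open>The rule for \<open>theta None\<close> puts a letter \<open>Some l\<close> in front of
  the first tensor factor where the original word had \<open>None\<close>. With weight 2 for
  \<open>None\<close> this is a strict decrease.\<close>

fun letter_weight :: "'m letter \<Rightarrow> nat" where
  "letter_weight None = 2"
| "letter_weight (Some _) = 1"

definition weight :: "'m word \<Rightarrow> nat" where
  "weight \<eta> = sum_list (map letter_weight \<eta>)"

lemma weight_simps [simp]:
  "weight [] = 0" "weight (k # \<eta>) = letter_weight k + weight \<eta>"
  by (simp_all add: weight_def)

lemma linear_theta: "linear (theta k)"
  unfolding theta_def by (rule linear_lin_ext)

lemma theta_basis [simp]: "theta k (basis (i, \<eta>)) = basis (i, k # \<eta>)"
  by (simp add: theta_def coord_def)

lemma linear_incl: "linear incl"
  unfolding incl_def by (rule linear_lin_ext)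

lemma incl_basis [simp]: "incl (basis x) = basis (Poly_Mapping.single x 1)"
  by (simp add: incl_def)

lemma linear_tensor_assoc: "linear tensor_assoc"
  unfolding tensor_assoc_def by (rule linear_lin_ext)

lemma tensor_assoc_basis [simp]: "tensor_assoc (basis ((x, y), z)) = basis (x, (y, z))"
  by (simp add: tensor_assoc_def)

lemma keys_tensor_mapE:
  assumes "z \<in> Poly_Mapping.keys (tensor_map F G t)"
  obtains x y x' y' where "(x, y) \<in> Poly_Mapping.keys t" "z = (x', y')"
    "x' \<in> Poly_Mapping.keys (F (basis x))" "y' \<in> Poly_Mapping.keys (G (basis y))"
  using assms unfolding tensor_map_def
  by (elim keys_lin_extE) (cases z, auto dest!: keys_tensorD)

primrec shuffle_cop :: "'m \<Rightarrow> 'm \<Rightarrow> 'm word \<Rightarrow> 'm VV" where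
  "shuffle_cop j i [] = tensor (coord i []) (coord j [])"
| "shuffle_cop j i (k # \<eta>) =
     tensor_map (theta k) id (shuffle_cop j i \<eta>) + tensor_map id (theta k) (shuffle_cop j i \<eta>)"

text \<open>Every basis vector arises from one with the empty word by maps \<open>theta k\<close>,
  so the recursion and linearity fix all values. Conversely, the commutation rules are identities of
  linear maps and hold on the basis by construction.\<close>

lemma shuffle_coproduct_rec_iff:
  "shuffle_coproduct_rec Dsh \<longleftrightarrow> Dsh = (\<lambda>j. lin_ext (\<lambda>(i, \<eta>). shuffle_cop j i \<eta>))"
proof
  assume rec: "shuffle_coproduct_rec Dsh"
  have theta: "Dsh j (theta k v) = tensor_map (theta k) id (Dsh j v) + tensor_map id (theta k) (Dsh j v)" for j k v
    using rec by (simp add: shuffle_coproduct_rec_def fun_eq_iff)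
  have "Dsh j (basis (i, \<eta>)) = shuffle_cop j i \<eta>" for j i \<eta>
  proof (induction \<eta>)
    case Nil
    then show ?case using rec by (simp add: shuffle_coproduct_rec_def coord_def)
  next
    case (Cons k \<eta>)
    then show ?case using theta[of j k "basis (i, \<eta>)"] by simp
  qed
  then have on_basis: "Dsh j (basis x) = (case x of (i, \<eta>) \<Rightarrow> shuffle_cop j i \<eta>)" for j x
    by (cases x) simp
  have "Dsh j v = lin_ext (\<lambda>(i, \<eta>). shuffle_cop j i \<eta>) v" for j v
    by (rule linear_eq_on_basis)
      (use rec in \<open>simp_all add: on_basis shuffle_coproduct_rec_def linear_lin_ext\<close>)
  then show "Dsh = (\<lambda>j. lin_ext (\<lambda>(i, \<eta>). shuffle_cop j i \<eta>))"
    by blast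
next
  assume Dsh: "Dsh = (\<lambda>j. lin_ext (\<lambda>(i, \<eta>). shuffle_cop j i \<eta>))"
  have lin: "linear (Dsh j)" for j unfolding Dsh by (rule linear_lin_ext)
  have "Dsh j (theta k v) = tensor_map (theta k) id (Dsh j v) + tensor_map id (theta k) (Dsh j v)" for j k v
  proof (rule linear_eq_on_basis[where F = "\<lambda>v. Dsh j (theta k v)"])
    show "linear (\<lambda>v. Dsh j (theta k v))"
      by (rule linear_comp[OF linear_theta lin])
    show "linear (\<lambda>v. tensor_map (theta k) id (Dsh j v) + tensor_map id (theta k) (Dsh j v))"
      by (intro linear_compose_add linear_comp[OF lin] linear_tensor_map)
    show "Dsh j (theta k (basis x)) =
        tensor_map (theta k) id (Dsh j (basis x)) + tensor_map id (theta k) (Dsh j (basis x))" for x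
      by (cases x) (simp add: Dsh)
  qed
  then show "shuffle_coproduct_rec Dsh"
    unfolding shuffle_coproduct_rec_def fun_eq_iff comp_apply using lin by (simp add: Dsh coord_def)
qed

text \<open>Each step attaches the new letter to exactly one of the two factors. The conserved
  weight serves both the termination of \<open>red_cop\<close> and the degree bound for its
  values.\<close>

lemma keys_shuffle_cop:
  "((i1, \<xi>), (i2, \<zeta>)) \<in> Poly_Mapping.keys (shuffle_cop j i \<eta>) \<Longrightarrow> weight \<xi> + weight \<zeta> = weight \<eta>"
proof (induction \<eta> arbitrary: i1 \<xi> i2 \<zeta>)
  case Nil
  then show ?case by (simp add: coord_def)
next
  case (Cons k \<eta>)
  from Cons.prems[unfolded shuffle_cop.simps, THEN keys_add[THEN subsetD]] consider
      "((i1, \<xi>), (i2, \<zeta>)) \<in> Poly_Mapping.keys (tensor_map (theta k) id (shuffle_cop j i \<eta>))"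
    | "((i1, \<xi>), (i2, \<zeta>)) \<in> Poly_Mapping.keys (tensor_map id (theta k) (shuffle_cop j i \<eta>))"
    by blast
  then show ?case
  proof cases
    case 1
    then obtain x y where xy: "(x, y) \<in> Poly_Mapping.keys (shuffle_cop j i \<eta>)"
      "(i1, \<xi>) \<in> Poly_Mapping.keys (theta k (basis x))" "(i2, \<zeta>) = y"
      by (rule keys_tensor_mapE) auto
    obtain i' \<xi>' where x: "x = (i', \<xi>')" by (cases x)
    show ?thesis using xy Cons.IH[of i' \<xi>' i2 \<zeta>] by (simp add: x)
  next
    case 2
    then obtain x y where xy: "(x, y) \<in> Poly_Mapping.keys (shuffle_cop j i \<eta>)"
      "(i1, \<xi>) = x" "(i2, \<zeta>) \<in> Poly_Mapping.keys (theta k (basis y))"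
      by (rule keys_tensor_mapE) auto
    obtain i' \<zeta>' where y: "y = (i', \<zeta>')" by (cases y)
    show ?thesis using xy Cons.IH[of i1 \<xi> i' \<zeta>'] by (simp add: y)
  qed
qed

text \<open>The map is the transpose of the shuffle product: \<open>theta k\<close> on a factor
  becomes a left shift of its functional, and the two summands of the recursion match the derivation
  rule. The functionals are arbitrary because the induction shifts them; the shuffle factors appear
  in the order used for modified composition.\<close>

lemma eval_shuffle_cop:
  fixes u v :: "'m::finite coord \<Rightarrow> real"
  shows "lin_ext (\<lambda>(x, y). u x * v y) (shuffle_cop j i \<eta>) = shuffle (\<lambda>\<zeta>. v (j, \<zeta>)) (\<lambda>\<xi>. u (i, \<xi>)) \<eta>"
proof (induction \<eta> arbitrary: u v)
  case Nil
  then show ?case by (simp add: coord_def shuffle_Nil)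
next
  case (Cons k \<eta>)
  let ?sh = "\<lambda>u. \<lambda>(i, \<eta>). u (i, k # \<eta>) :: real"
  have left: "lin_ext (\<lambda>(x, y). u x * v y) (tensor_map (theta k) id t) =
      lin_ext (\<lambda>(x, y). ?sh u x * v y) t" for t :: "'m VV"
    by (rule linear_eq_on_basis[OF linear_comp[OF linear_tensor_map linear_lin_ext] linear_lin_ext]) auto
  have right: "lin_ext (\<lambda>(x, y). u x * v y) (tensor_map id (theta k) t) =
      lin_ext (\<lambda>(x, y). u x * ?sh v y) t" for t :: "'m VV"
    by (rule linear_eq_on_basis[OF linear_comp[OF linear_tensor_map linear_lin_ext] linear_lin_ext]) auto
  show ?case
    by (simp add: linear_add[OF linear_lin_ext] left right Cons.IH shuffle_Cons shift_def)
qed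

text \<open>The factor \<open>tensor_map T incl\<close> of the recursion is expanded on the basis,
  so that the recursive calls become visible. They are made at words no heavier than the tail
  \<open>\<eta>\<close>, although not necessarily at \<open>\<eta>\<close> itself.\<close>

function red_cop :: "'m::finite \<Rightarrow> 'm word \<Rightarrow> 'm VH" where
  "red_cop i [] = tensor (coord i []) 1"
| "red_cop i (Some l # \<eta>) = tensor_map (theta (Some l)) id (red_cop i \<eta>)"
| "red_cop i (None # \<eta>) = tensor_map (theta None) id (red_cop i \<eta>) +
     (\<Sum>l\<in>UNIV. tensor_map (theta (Some l)) mult (tensor_assoc
       (lin_ext (\<lambda>((i', \<xi>), y). tensor (red_cop i' \<xi>) (incl (basis y))) (shuffle_cop l i \<eta>))))"
  by pat_completeness auto
termination
  by (relation "Wellfounded.measure (\<lambda>(i, \<eta>). weight \<eta>)") (auto dest!: keys_shuffle_cop)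

definition fun_VH :: "'m::finite VH \<Rightarrow> 'm series \<Rightarrow> 'm series \<Rightarrow> real" where
  "fun_VH t c d = lin_ext (\<lambda>(x, p). coord_value c x * monom_fun p d) t"

lemma linear_fun_VH: "linear (\<lambda>t. fun_VH t c d)"
  unfolding fun_VH_def by (rule linear_lin_ext)

lemma fun_VH_basis [simp]: "fun_VH (basis (x, p)) c d = coord_value c x * monom_fun p d"
  by (simp add: fun_VH_def)

lemma fun_VH_theta: "fun_VH (tensor_map (theta k) id t) c d = fun_VH t (shift k c) d"
  by (rule linear_eq_on_basis[OF linear_comp[OF linear_tensor_map linear_fun_VH] linear_fun_VH])
    (auto simp: coord_value_def component_def shift_def)

text \<open>After evaluation, multiplying into the second tensor factor becomes multiplication by a
  number read off from \<open>d\<close>, so the summand of the rule for \<open>theta None\<close> is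
  again a value at a shifted series.\<close>

lemma fun_VH_theta_mult:
  fixes c d :: "'m::finite series"
  shows "fun_VH (tensor_map (theta k) mult (tensor_assoc (tensor t (incl (basis y))))) c d =
    fun_VH t (shift k c) d * coord_value d y"
proof (rule linear_eq_on_basis[of "\<lambda>t. fun_VH (tensor_map (theta k) mult (tensor_assoc (tensor t (incl (basis y))))) c d"])
  show "linear (\<lambda>t. fun_VH (tensor_map (theta k) mult (tensor_assoc (tensor t (incl (basis y))))) c d)"
    by (intro linear_comp[OF linear_tensor_left] linear_comp[OF linear_tensor_assoc]
        linear_comp[OF linear_tensor_map] linear_fun_VH)
  show "linear (\<lambda>t. fun_VH t (shift k c) d * coord_value d y)"
    by (rule linear_comp[OF linear_fun_VH linear_mult_left])
  fix x :: "'m coord \<times> 'm monom"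
  obtain i \<eta> p where "x = ((i, \<eta>), p)" by (cases x) auto
  then show "fun_VH (tensor_map (theta k) mult (tensor_assoc (tensor (basis x) (incl (basis y))))) c d =
      fun_VH (basis x) (shift k c) d * coord_value d y"
    by (simp add: basis_add[symmetric] monom_fun_add monom_fun_single)
      (simp add: coord_value_def component_def shift_def)
qed

text \<open>Both sides obey the same recursion in the word. The series \<open>c\<close> must vary,
  since every step replaces it by a shift; for \<open>None\<close>, \<open>eval_shuffle_cop\<close>
  is used with the coordinates of the shifted composition and those of \<open>d\<close>.\<close>

lemma fun_VH_red_cop: "fun_VH (red_cop i \<eta>) c d = component (modified_comp c d) i \<eta>"
proof (induction i \<eta> arbitrary: c rule: red_cop.induct)
  case (1 i)
  then show ?case by (simp add: coord_def coord_value_def monom_fun_0 component_modified_comp_Nil)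
next
  case (2 i l \<eta>)
  then show ?case by (simp add: fun_VH_theta component_modified_comp_Cons)
next
  case (3 i \<eta>)
  have "fun_VH (tensor_map (theta (Some l)) mult (tensor_assoc
      (lin_ext (\<lambda>((i', \<xi>), y). tensor (red_cop i' \<xi>) (incl (basis y))) (shuffle_cop l i \<eta>)))) c d =
    shuffle (component d l) (component (modified_comp (shift (Some l) c) d) i) \<eta>" (is "?L l = _") for l
  proof -
    let ?F = "\<lambda>t. fun_VH (tensor_map (theta (Some l)) mult (tensor_assoc t)) c d"
    have lin: "linear ?F"
      by (intro linear_comp[OF linear_tensor_assoc] linear_comp[OF linear_tensor_map] linear_fun_VH)
    have "?F (case z of ((i', \<xi>), y) \<Rightarrow> tensor (red_cop i' \<xi>) (incl (basis y))) =
        (case z of (x, y) \<Rightarrow> coord_value (modified_comp (shift (Some l) c) d) x * coord_value d y)"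
      if z: "z \<in> Poly_Mapping.keys (shuffle_cop l i \<eta>)" for z
    proof -
      obtain i' \<xi> y where eq: "z = ((i', \<xi>), y)" by (metis surj_pair)
      show ?thesis
        using 3(2)[OF UNIV_I z, of "(i', \<xi>)" y i' \<xi> "shift (Some l) c"]
        by (simp add: eq fun_VH_theta_mult del: incl_basis) (simp add: coord_value_def)
    qed
    then have "?L l = lin_ext (\<lambda>(x, y). coord_value (modified_comp (shift (Some l) c) d) x * coord_value d y)
        (shuffle_cop l i \<eta>)"
      unfolding lin_ext_comp[OF lin] by (intro lin_ext_cong refl) (simp add: case_prod_unfold)
    then show ?thesis
      by (simp add: eval_shuffle_cop) (simp add: coord_value_def)
  qed
  then show ?case
    by (simp add: linear_add[OF linear_fun_VH] linear_sum[OF linear_fun_VH] fun_VH_theta 3(1)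
        component_modified_comp_Cons)
qed

lemma red_coproduct_rec_iff:
  fixes T :: "'m::finite Vplus \<Rightarrow> 'm VH"
  shows "red_coproduct_rec (\<lambda>j. lin_ext (\<lambda>(i, \<eta>). shuffle_cop j i \<eta>)) T \<longleftrightarrow> T = lin_ext (\<lambda>(i, \<eta>). red_cop i \<eta>)"
    (is "red_coproduct_rec ?Dsh T \<longleftrightarrow> T = ?T")
proof
  assume rec: "red_coproduct_rec ?Dsh T"
  have theta_Some: "T (theta (Some l) v) = tensor_map (theta (Some l)) id (T v)" for l v
    using rec by (simp add: red_coproduct_rec_def fun_eq_iff)
  have theta_None: "T (theta None v) = tensor_map (theta None) id (T v) +
      (\<Sum>l\<in>UNIV. tensor_map (theta (Some l)) mult (tensor_assoc (tensor_map T incl (?Dsh l v))))" for v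
    using rec unfolding red_coproduct_rec_def fun_eq_iff comp_apply by blast
  have "T (basis (i, \<eta>)) = red_cop i \<eta>" for i \<eta>
  proof (induction i \<eta> rule: red_cop.induct)
    case (1 i)
    then show ?case using rec by (simp add: red_coproduct_rec_def coord_def)
  next
    case (2 i l \<eta>)
    then show ?case using theta_Some[of l "basis (i, \<eta>)"] by simp
  next
    case (3 i \<eta>)
    \<comment> \<open>At this point \<open>T\<close> is known to agree with \<open>red_cop\<close>
      only at words that occur in the shuffle coproduct, which is all that the expansion
      uses.\<close>
    have "tensor_map T incl (shuffle_cop l i \<eta>) =
        lin_ext (\<lambda>((i', \<xi>), y). tensor (red_cop i' \<xi>) (incl (basis y))) (shuffle_cop l i \<eta>)" for l
      unfolding tensor_map_def
    proof (rule lin_ext_cong[OF refl])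
      fix z
      assume z: "z \<in> Poly_Mapping.keys (shuffle_cop l i \<eta>)"
      obtain i' \<xi> y where eq: "z = ((i', \<xi>), y)" by (metis surj_pair)
      show "(case z of (x, y) \<Rightarrow> tensor (T (basis x)) (incl (basis y))) =
          (\<lambda>((i', \<xi>), y). tensor (red_cop i' \<xi>) (incl (basis y))) z"
        using 3(2)[OF UNIV_I z, of "(i', \<xi>)" y i' \<xi>] by (simp add: eq)
    qed
    then show ?case
      using theta_None[of "basis (i, \<eta>)"] 3(1) by simp
  qed
  then have on_basis: "T (basis x) = (case x of (i, \<eta>) \<Rightarrow> red_cop i \<eta>)" for x
    by (cases x) simp
  have "T v = ?T v" for v
    by (rule linear_eq_on_basis)
      (use rec in \<open>simp_all add: on_basis red_coproduct_rec_def linear_lin_ext\<close>)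
  then show "T = ?T" by blast
next
  assume T: "T = ?T"
  have lin: "linear T" unfolding T by (rule linear_lin_ext)
  have T_basis: "T (basis (i, \<eta>)) = red_cop i \<eta>" for i \<eta>
    by (simp add: T)
  have theta_Some: "T (theta (Some l) v) = tensor_map (theta (Some l)) id (T v)" for l v
  proof (rule linear_eq_on_basis[where F = "\<lambda>v. T (theta (Some l) v)"])
    show "T (theta (Some l) (basis x)) = tensor_map (theta (Some l)) id (T (basis x))" for x
      by (cases x) (simp add: T_basis)
  qed (intro linear_comp[OF linear_theta lin] linear_comp[OF lin linear_tensor_map])+
  have theta_None: "T (theta None v) = tensor_map (theta None) id (T v) +
      (\<Sum>l\<in>UNIV. tensor_map (theta (Some l)) mult (tensor_assoc (tensor_map T incl (?Dsh l v))))"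
    (is "_ = ?rhs v") for v
  proof (rule linear_eq_on_basis[where F = "\<lambda>v. T (theta None v)"])
    show "linear (\<lambda>v. T (theta None v))" by (rule linear_comp[OF linear_theta lin])
    show "linear ?rhs"
      by (intro linear_compose_add linear_compose_sum ballI linear_comp[OF lin linear_tensor_map]
          linear_comp[OF linear_lin_ext] linear_comp[OF linear_tensor_map] linear_comp[OF linear_tensor_assoc]
          linear_tensor_map)
    show "T (theta None (basis x)) = ?rhs (basis x)" for x
    proof -
      obtain i \<eta> where x: "x = (i, \<eta>)" by (cases x)
      have "tensor_map T incl t =
          lin_ext (\<lambda>((i', \<xi>), y). tensor (red_cop i' \<xi>) (incl (basis y))) t" for t :: "'m VV"
        unfolding tensor_map_def by (intro lin_ext_cong refl) (auto simp: T_basis)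
      then show ?thesis by (simp add: x T_basis id_def)
    qed
  qed
  show "red_coproduct_rec ?Dsh T"
    unfolding red_coproduct_rec_def fun_eq_iff comp_apply
    using lin theta_Some theta_None by (simp add: T_basis coord_def)
qed

section \<open>Comparison with the Hopf coproduct, and degree bounds\<close>

lemma fun_HH_tensor_map_incl: "fun_HH (tensor_map incl id t) c d = fun_VH t c d"
proof (rule linear_eq_on_basis[where F = "\<lambda>t. fun_HH (tensor_map incl id t) c d"])
  show "linear (\<lambda>t. fun_HH (tensor_map incl id t) c d)"
    unfolding fun_HH_def by (rule linear_comp[OF linear_tensor_map linear_lin_ext])
  show "fun_HH (tensor_map incl id (basis x)) c d = fun_VH (basis x) c d" for x
    by (cases x) (simp add: fun_HH_def monom_fun_single)
qed (rule linear_fun_VH)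

lemma tensor_map_incl_red_cop:
  fixes \<Delta> :: "'m::finite H \<Rightarrow> 'm HH"
  assumes "is_coproduct \<Delta>"
  shows "tensor_map incl id (red_cop i \<eta>) = \<Delta> (incl (coord i \<eta>)) - tensor 1 (incl (coord i \<eta>))"
proof -
  have "fun_HH (tensor_map incl id (red_cop i \<eta>) - (\<Delta> (incl (coord i \<eta>)) - tensor 1 (incl (coord i \<eta>)))) c d = 0"
    for c d
  proof -
    have "fun_HH (s - t) c d = fun_HH s c d - fun_HH t c d" for s t
      unfolding fun_HH_def by (rule linear_diff[OF linear_lin_ext])
    moreover have "fun_HH (\<Delta> (incl (coord i \<eta>))) c d = component (feedback_prod c d) i \<eta>"
      using assms by (simp add: is_coproduct_def)
    moreover have "fun_HH (tensor 1 (incl (coord i \<eta>))) c d = component d i \<eta>"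
      by (simp add: fun_HH_def coord_def monom_fun_0 monom_fun_single) (simp add: coord_value_def)
    ultimately show ?thesis
      by (simp only: fun_HH_tensor_map_incl fun_VH_red_cop)
        (simp add: feedback_prod_def component_def)
  qed
  then show ?thesis using fun_HH_eq_0D by fastforce
qed

lemma red_coproduct_identity:
  fixes \<Delta> :: "'m::finite H \<Rightarrow> 'm HH"
  assumes "is_coproduct \<Delta>"
  shows "tensor_map incl id (lin_ext (\<lambda>(i, \<eta>). red_cop i \<eta>) v) = \<Delta> (incl v) - tensor 1 (incl v)"
proof (rule linear_eq_on_basis[where F = "\<lambda>v. tensor_map incl id (lin_ext (\<lambda>(i, \<eta>). red_cop i \<eta>) v)"])
  have "linear \<Delta>" using assms by (simp add: is_coproduct_def unital_alg_hom_def)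
  then show "linear (\<lambda>v. \<Delta> (incl v) - tensor 1 (incl v))"
    by (intro linear_compose_sub linear_comp[OF linear_incl] linear_tensor_right)
  show "linear (\<lambda>v. tensor_map incl id (lin_ext (\<lambda>(i, \<eta>). red_cop i \<eta>) v) :: 'm HH)"
    by (rule linear_comp[OF linear_lin_ext linear_tensor_map])
  show "tensor_map incl id (lin_ext (\<lambda>(i, \<eta>). red_cop i \<eta>) (basis x)) =
      \<Delta> (incl (basis x)) - tensor 1 (incl (basis x))" for x
    using tensor_map_incl_red_cop[OF assms] by (cases x) (simp add: coord_def)
qed

text \<open>In the terms of the paper, \<open>deg a\<^sup>i\<^sub>\<eta> = weight \<eta> + 1\<close>.\<close>

definition mdeg :: "'m monom \<Rightarrow> nat" where
  "mdeg p = (\<Sum>x\<in>Poly_Mapping.keys p. Poly_Mapping.lookup p x * (weight (snd x) + 1))"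

lemma mdeg_superset:
  assumes "finite A" "Poly_Mapping.keys p \<subseteq> A"
  shows "mdeg p = (\<Sum>x\<in>A. Poly_Mapping.lookup p x * (weight (snd x) + 1))"
  unfolding mdeg_def
  by (rule sum.mono_neutral_left) (use assms in \<open>auto simp: in_keys_iff\<close>)

lemma mdeg_0 [simp]: "mdeg 0 = 0"
  by (simp add: mdeg_def)

lemma mdeg_add [simp]: "mdeg (p + q) = mdeg p + mdeg q"
proof -
  let ?A = "Poly_Mapping.keys p \<union> Poly_Mapping.keys q"
  have sub: "Poly_Mapping.keys (p + q) \<subseteq> ?A" by (rule keys_add)
  show ?thesis
    by (simp only: mdeg_superset[of ?A, OF _ sub] mdeg_superset[of ?A p] mdeg_superset[of ?A q]
        finite_keys finite_UnI Un_upper1 Un_upper2 lookup_add add_mult_distrib sum.distrib)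
qed

lemma mdeg_single [simp]: "mdeg (Poly_Mapping.single (i, \<eta>) (Suc 0)) = weight \<eta> + 1"
  by (subst mdeg_superset[of "{(i, \<eta>)}"]) auto

lemma keys_theta_id:
  assumes "z \<in> Poly_Mapping.keys (tensor_map (theta k) id t)"
  obtains j \<xi> p where "((j, \<xi>), p) \<in> Poly_Mapping.keys t" "z = ((j, k # \<xi>), p)"
proof -
  from assms obtain x p where "(x, p) \<in> Poly_Mapping.keys t" "fst z \<in> Poly_Mapping.keys (theta k (basis x))" "snd z = p"
    by (rule keys_tensor_mapE) auto
  then show thesis using that by (cases x, cases z) auto
qed

text \<open>This makes both recursions for the antipode well founded.\<close>

lemma keys_red_cop:
  "Poly_Mapping.keys (red_cop i \<eta> - basis ((i, \<eta>), 0)) \<subseteq> {((j, \<xi>), p). weight \<xi> < weight \<eta> \<and> mdeg p \<le> weight \<eta>}"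
proof (induction i \<eta> rule: red_cop.induct)
  case (1 i)
  then show ?case by (simp add: coord_def)
next
  case (2 i l \<eta>)
  have eq: "red_cop i (Some l # \<eta>) - basis ((i, Some l # \<eta>), 0) =
      tensor_map (theta (Some l)) id (red_cop i \<eta> - basis ((i, \<eta>), 0))"
    by (simp add: linear_diff[OF linear_tensor_map])
  show ?case
  proof
    fix z
    assume "z \<in> Poly_Mapping.keys (red_cop i (Some l # \<eta>) - basis ((i, Some l # \<eta>), 0))"
    then obtain j \<xi> p where "((j, \<xi>), p) \<in> Poly_Mapping.keys (red_cop i \<eta> - basis ((i, \<eta>), 0))"
      "z = ((j, Some l # \<xi>), p)"
      unfolding eq by (rule keys_theta_id)
    with 2 show "z \<in> {((j, \<xi>), p). weight \<xi> < weight (Some l # \<eta>) \<and> mdeg p \<le> weight (Some l # \<eta>)}"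
      by auto
  qed
next
  case (3 i \<eta>)
  \<comment> \<open>Restoring the leading term \<open>basis ((i1, \<xi>), 0)\<close> costs the
    strictness of the first bound; the exchange of \<open>None\<close> for \<open>Some l\<close>
    recovers it below.\<close>
  have le: "weight \<xi>' \<le> weight \<xi> \<and> mdeg p \<le> weight \<xi>"
    if "((i1, \<xi>), y) \<in> Poly_Mapping.keys (shuffle_cop l i \<eta>)" "((j, \<xi>'), p) \<in> Poly_Mapping.keys (red_cop i1 \<xi>)"
    for i1 \<xi> y l j \<xi>' p
  proof -
    have "((j, \<xi>'), p) \<in> Poly_Mapping.keys (red_cop i1 \<xi> - basis ((i1, \<xi>), 0)) \<or> ((j, \<xi>'), p) = ((i1, \<xi>), 0)"
      using that(2) by (auto simp: in_keys_iff lookup_minus basis_def lookup_single when_def)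
    with 3(2)[OF UNIV_I that(1), of "(i1, \<xi>)" y i1 \<xi>] show ?thesis by auto
  qed
  have eq: "red_cop i (None # \<eta>) - basis ((i, None # \<eta>), 0) =
      tensor_map (theta None) id (red_cop i \<eta> - basis ((i, \<eta>), 0)) +
      (\<Sum>l\<in>UNIV. tensor_map (theta (Some l)) mult (tensor_assoc
       (lin_ext (\<lambda>((i', \<xi>), y). tensor (red_cop i' \<xi>) (incl (basis y))) (shuffle_cop l i \<eta>))))"
    by (simp add: linear_diff[OF linear_tensor_map])
  show ?case
  proof
    fix z
    assume "z \<in> Poly_Mapping.keys (red_cop i (None # \<eta>) - basis ((i, None # \<eta>), 0))"
    then have "z \<in> Poly_Mapping.keys (tensor_map (theta None) id (red_cop i \<eta> - basis ((i, \<eta>), 0))) \<or>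
        (\<exists>l. z \<in> Poly_Mapping.keys (tensor_map (theta (Some l)) mult (tensor_assoc
          (lin_ext (\<lambda>((i', \<xi>), y). tensor (red_cop i' \<xi>) (incl (basis y))) (shuffle_cop l i \<eta>)))))"
      unfolding eq by (elim keys_add[THEN subsetD, elim_format] UnE) (auto dest!: keys_sum[THEN subsetD])
    then consider "z \<in> Poly_Mapping.keys (tensor_map (theta None) id (red_cop i \<eta> - basis ((i, \<eta>), 0)))"
      | l where "z \<in> Poly_Mapping.keys (tensor_map (theta (Some l)) mult (tensor_assoc
       (lin_ext (\<lambda>((i', \<xi>), y). tensor (red_cop i' \<xi>) (incl (basis y))) (shuffle_cop l i \<eta>))))"
      by blast
    then show "z \<in> {((j, \<xi>), p). weight \<xi> < weight (None # \<eta>) \<and> mdeg p \<le> weight (None # \<eta>)}"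
    proof cases
      case 1
      then obtain j \<xi> p where "((j, \<xi>), p) \<in> Poly_Mapping.keys (red_cop i \<eta> - basis ((i, \<eta>), 0))"
        "z = ((j, None # \<xi>), p)"
        by (rule keys_theta_id)
      with 3(1) show ?thesis by auto
    next
      case (2 l)
      then obtain x q x' q' where xq: "(x, q) \<in> Poly_Mapping.keys (tensor_assoc
          (lin_ext (\<lambda>((i', \<xi>), y). tensor (red_cop i' \<xi>) (incl (basis y))) (shuffle_cop l i \<eta>)))"
        and z: "z = (x', q')" "x' \<in> Poly_Mapping.keys (theta (Some l) (basis x))"
          "q' \<in> Poly_Mapping.keys (mult (basis q))"
        by (rule keys_tensor_mapE)
      from xq obtain w where
        w: "w \<in> Poly_Mapping.keys (lin_ext (\<lambda>((i', \<xi>), y). tensor (red_cop i' \<xi>) (incl (basis y))) (shuffle_cop l i \<eta>))"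
        and "(x, q) \<in> Poly_Mapping.keys ((\<lambda>((x, y), z). basis (x, (y, z))) w)"
        unfolding tensor_assoc_def by (rule keys_lin_extE)
      then obtain q1 q2 where q: "w = ((x, q1), q2)" "q = (q1, q2)"
        by (cases w) auto
      from w obtain v where v: "v \<in> Poly_Mapping.keys (shuffle_cop l i \<eta>)"
        and wv: "w \<in> Poly_Mapping.keys ((\<lambda>((i', \<xi>), y). tensor (red_cop i' \<xi>) (incl (basis y))) v)"
        by (rule keys_lin_extE)
      obtain i1 \<xi> i2 \<zeta> where veq: "v = ((i1, \<xi>), (i2, \<zeta>))" by (metis surj_pair)
      have "(x, q1) \<in> Poly_Mapping.keys (red_cop i1 \<xi>)" and q2: "q2 = Poly_Mapping.single (i2, \<zeta>) (Suc 0)"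
        using wv by (auto simp: veq q dest!: keys_tensorD)
      moreover obtain j \<xi>' where x: "x = (j, \<xi>')" by (cases x)
      ultimately have "weight \<xi>' \<le> weight \<xi> \<and> mdeg q1 \<le> weight \<xi>"
        using le v veq by blast
      moreover have "weight \<xi> + weight \<zeta> = weight \<eta>"
        using v unfolding veq by (rule keys_shuffle_cop)
      moreover have "x' = (j, Some l # \<xi>')" "q' = q1 + q2"
        using z by (simp_all add: x q basis_add[symmetric])
      \<comment> \<open>The first factor has weight
        \<open>1 + weight \<xi>' \<le> 1 + weight \<eta>\<close>, below
        \<open>2 + weight \<eta>\<close>. The second has degree
        \<open>mdeg q1 + weight \<zeta> + 1\<close>, at most \<open>weight \<eta> + 1\<close> by
        conservation of weight.\<close>
      ultimately show ?thesis by (simp add: z q2)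
    qed
  qed
qed

section \<open>Triangularity of the coproduct and convolution inverses\<close>

text \<open>Exponents grow by one generator at a time, even at a coordinate already present, which
  is the form in which multiplicativity of the coproduct applies.\<close>

lemma monom_induct [case_names zero add]:
  fixes P :: "('a \<Rightarrow>\<^sub>0 nat) \<Rightarrow> bool"
  assumes "P 0" and add: "\<And>p x. P p \<Longrightarrow> P (p + Poly_Mapping.single x (Suc 0))"
  shows "P p"
proof (induction p rule: Poly_Mapping.update_induct)
  case (update f a b)
  have "P (f + Poly_Mapping.single a n)" for n
  proof (induction n)
    case (Suc n)
    have "f + Poly_Mapping.single a (Suc n) = f + Poly_Mapping.single a n + Poly_Mapping.single a (Suc 0)"
      by (simp add: add.assoc single_add[symmetric])
    with add[OF Suc] show ?case by simp
  qed (use update in simp)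
  moreover have "Poly_Mapping.update a b f = f + Poly_Mapping.single a b"
    by (rule poly_mapping_eqI)
      (use update in \<open>auto simp: Poly_Mapping.lookup_update lookup_add lookup_single when_def in_keys_iff\<close>)
  ultimately show ?case by simp
qed (fact assms)

text \<open>The difference is the reduced coproduct. Its leading term has second factor 1, and all
  other second factors have degree at most the weight of the word, one less than the degree of the
  generator.\<close>

lemma keys_coproduct_generator:
  fixes \<Delta> :: "'m::finite H \<Rightarrow> 'm HH"
  assumes "is_coproduct \<Delta>"
  shows "Poly_Mapping.keys (\<Delta> (basis (Poly_Mapping.single x (Suc 0))) - basis (0, Poly_Mapping.single x (Suc 0))) \<subseteq>
    {(p, q). mdeg q < mdeg (Poly_Mapping.single x (Suc 0))}"
proof -
  obtain i \<eta> where x: "x = (i, \<eta>)" by (cases x)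
  have eq: "\<Delta> (basis (Poly_Mapping.single x (Suc 0))) - basis (0, Poly_Mapping.single x (Suc 0)) =
      tensor_map incl id (red_cop i \<eta>)"
    using tensor_map_incl_red_cop[OF assms, of i \<eta>] by (simp add: x coord_def)
  have "mdeg q \<le> weight \<eta>" if "(y, q) \<in> Poly_Mapping.keys (red_cop i \<eta>)" for y q
  proof -
    have "(y, q) \<in> Poly_Mapping.keys (red_cop i \<eta> - basis ((i, \<eta>), 0)) \<or> (y, q) = ((i, \<eta>), 0)"
      using that by (auto simp: in_keys_iff lookup_minus basis_def lookup_single when_def)
    with keys_red_cop[of i \<eta>] show ?thesis by auto
  qed
  then show ?thesis
    unfolding eq by (auto simp: x less_Suc_eq_le elim!: keys_tensor_mapE)
qed

text \<open>In the product of two coproducts, each split as lower terms plus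
  \<open>1 \<otimes> p\<close>, full degree in the second factor is reached only by the product of
  the two split-off terms; the other three products lose degree in at least one factor.\<close>

lemma keys_coproduct_monom:
  fixes \<Delta> :: "'m::finite H \<Rightarrow> 'm HH"
  assumes "is_coproduct \<Delta>"
  shows "Poly_Mapping.keys (\<Delta> (basis p) - basis (0, p)) \<subseteq> {(p', q). mdeg q < mdeg p}"
proof (induction p rule: monom_induct)
  case zero
  have "\<Delta> 1 = 1" using assms by (simp add: is_coproduct_def unital_alg_hom_def)
  then show ?case by (simp add: basis_0 flip: zero_prod_def)
next
  case (add p x)
  let ?x = "Poly_Mapping.single x (Suc 0)"
  define A where "A = \<Delta> (basis p) - basis (0, p)"
  define B where "B = \<Delta> (basis ?x) - basis (0, ?x)"
  have A: "Poly_Mapping.keys A \<subseteq> {(p', q). mdeg q < mdeg p}"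
    using add by (simp add: A_def)
  have B: "Poly_Mapping.keys B \<subseteq> {(p', q). mdeg q < mdeg ?x}"
    unfolding B_def by (rule keys_coproduct_generator[OF assms])
  have "\<Delta> (basis (p + ?x)) = (A + basis (0, p)) * (B + basis (0, ?x))"
    using assms by (simp add: A_def B_def basis_add is_coproduct_def unital_alg_hom_def)
  also have "\<dots> = A * B + A * basis (0, ?x) + basis (0, p) * B + basis (0, p + ?x)"
    using basis_add[of "(0 :: 'm monom, p)" "(0, ?x)"] by (simp add: algebra_simps)
  finally have eq: "\<Delta> (basis (p + ?x)) - basis (0, p + ?x) = A * B + A * basis (0, ?x) + basis (0, p) * B"
    by simp
  have "Poly_Mapping.keys (A * B) \<subseteq> {(p', q). mdeg q < mdeg (p + ?x)}"
    using keys_mult[of A B] A B by fastforce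
  moreover have "Poly_Mapping.keys (A * basis (0, ?x)) \<subseteq> {(p', q). mdeg q < mdeg (p + ?x)}"
    using keys_mult[of A "basis (0, ?x)"] A by fastforce
  moreover have "Poly_Mapping.keys (basis (0, p) * B) \<subseteq> {(p', q). mdeg q < mdeg (p + ?x)}"
    using keys_mult[of "basis (0, p)" B] B by fastforce
  moreover have "Poly_Mapping.keys (A * B + A * basis (0, ?x) + basis (0, p) * B) \<subseteq>
      Poly_Mapping.keys (A * B) \<union> Poly_Mapping.keys (A * basis (0, ?x)) \<union> Poly_Mapping.keys (basis (0, p) * B)"
    using keys_add[of "A * B" "A * basis (0, ?x)"]
      keys_add[of "A * B + A * basis (0, ?x)" "basis (0, p) * B"] by blast
  ultimately show ?case unfolding eq by blast
qed

text \<open>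
  Since \<open>\<Delta> p - 1 \<otimes> p\<close> only involves second factors of smaller degree than \<open>p\<close>, coassociativity
  is not needed here.
\<close>

lemma right_convolution_cancel:
  fixes \<Delta> :: "'m::finite H \<Rightarrow> 'm HH"
  assumes "is_coproduct \<Delta>" "linear R" "linear S"
    and eq: "\<And>p. mult (tensor_map id R (\<Delta> p)) = mult (tensor_map id S (\<Delta> p))"
  shows "R = S"
proof -
  have lin: "linear (\<lambda>t. mult (tensor_map id F t))" for F :: "'m H \<Rightarrow> 'm H"
    by (rule linear_comp[OF linear_tensor_map linear_mult])
  have "R (basis p) = S (basis p)" for p
  proof (induction "mdeg p" arbitrary: p rule: less_induct)
    case less
    define A where "A = \<Delta> (basis p) - basis (0, p)"
    \<comment> \<open>The term \<open>1 \<otimes> p\<close> contributes exactly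
      \<open>F (basis p)\<close>, so this value is determined by the convolution and the values of
      \<open>F\<close> in lower degrees.\<close>
    have split: "mult (tensor_map id F (\<Delta> (basis p))) = mult (tensor_map id F A) + F (basis p)"
      for F :: "'m H \<Rightarrow> 'm H"
    proof -
      have "\<Delta> (basis p) = A + basis (0, p)" by (simp add: A_def)
      then show ?thesis by (simp add: linear_add[OF lin] mult_tensor basis_0)
    qed
    have "tensor_map id R A = tensor_map id S A"
      unfolding tensor_map_def
    proof (rule lin_ext_cong[OF refl])
      fix z
      assume "z \<in> Poly_Mapping.keys A"
      then have "mdeg (snd z) < mdeg p"
        using keys_coproduct_monom[OF assms(1), of p] by (auto simp: A_def)
      then show "(case z of (x, y) \<Rightarrow> tensor (id (basis x)) (R (basis y))) =
          (case z of (x, y) \<Rightarrow> tensor (id (basis x)) (S (basis y)))"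
        using less by (simp add: case_prod_unfold)
    qed
    then show ?case using eq[of "basis p"] by (simp add: split)
  qed
  from linear_eq_on_basis[OF assms(2,3) this] have "R p = S p" for p .
  then show ?thesis by blast
qed

lemma counit_basis_add: "counit (basis (p + Poly_Mapping.single x (Suc 0))) = 0"
proof -
  have "Poly_Mapping.lookup (p + Poly_Mapping.single x (Suc 0)) x \<noteq> 0" by (simp add: lookup_add)
  then have "p + Poly_Mapping.single x (Suc 0) \<noteq> 0" by force
  then show ?thesis by (simp add: counit_def basis_def lookup_single when_def)
qed

text \<open>Since \<open>H\<close> is commutative, \<open>p \<mapsto> \<mu> ((id \<otimes> R) (\<Delta> p))\<close> is an algebra homomorphism.\<close>

lemma right_convolution_counit:
  fixes \<Delta> :: "'m::finite H \<Rightarrow> 'm HH"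
  assumes "is_coproduct \<Delta>" "unital_alg_hom R"
    and gen: "\<And>i \<eta>. mult (tensor_map id R (\<Delta> (incl (coord i \<eta>)))) = 0"
  shows "mult (tensor_map id R (\<Delta> p)) = counit p *\<^sub>R 1"
proof (rule linear_eq_on_basis[where F = "\<lambda>p. mult (tensor_map id R (\<Delta> p))"])
  let ?G = "\<lambda>t. mult (tensor_map id R t)"
  have hom: "linear \<Delta>" "\<Delta> 1 = 1" "\<And>p q. \<Delta> (p * q) = \<Delta> p * \<Delta> q"
    using assms(1) by (auto simp: is_coproduct_def unital_alg_hom_def)
  have R: "linear R" "R 1 = 1" "\<And>p q. R (p * q) = R p * R q"
    using assms(2) by (auto simp: unital_alg_hom_def)
  have lin: "linear ?G"
    by (rule linear_comp[OF linear_tensor_map linear_mult])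
  have G_mult: "?G (s * t) = ?G s * ?G t" for s t
  proof (rule multiplicative_on_basis[OF lin])
    fix x y :: "'m monom \<times> 'm monom"
    show "?G (basis (x + y)) = ?G (basis x) * ?G (basis y)"
      by (cases x; cases y) (simp add: mult_tensor basis_add R(3) mult_ac)
  qed
  show "linear (\<lambda>p. ?G (\<Delta> p))"
    by (rule linear_comp[OF hom(1) lin])
  show "linear (\<lambda>p. counit p *\<^sub>R (1 :: 'm H))"
    unfolding counit_def by (simp add: linear_iff lookup_add lookup_scaleR scaleR_add_left)
  fix p :: "'m monom"
  show "?G (\<Delta> (basis p)) = counit (basis p) *\<^sub>R 1"
  proof (induction p rule: monom_induct)
    case zero
    have "?G (basis (0, 0)) = 1" by (simp add: mult_tensor basis_0 R(2))
    then show ?case by (simp add: basis_0 hom(2) counit_def id_def flip: zero_prod_def)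
  next
    case (add p x)
    have "?G (\<Delta> (basis (Poly_Mapping.single x (Suc 0)))) = 0"
      using gen[of "fst x" "snd x"] by (simp add: coord_def)
    \<comment> \<open>One generator with vanishing convolution annihilates the whole monomial by
      multiplicativity, in agreement with the counit.\<close>
    then have "?G (\<Delta> (basis (p + Poly_Mapping.single x (Suc 0)))) = 0"
      by (simp only: basis_add hom(3) G_mult mult_zero_right)
    then show ?case by (simp only: counit_basis_add scaleR_zero_left)
  qed
qed

section \<open>The two antipode recursions\<close>

lemma tensor_map_comp:
  assumes "linear F'" "linear G'"
  shows "tensor_map F' G' (tensor_map F G t) = tensor_map (F' \<circ> F) (G' \<circ> G) t"
proof (rule linear_eq_on_basis[where F = "\<lambda>t. tensor_map F' G' (tensor_map F G t)"])
  show "linear (\<lambda>t. tensor_map F' G' (tensor_map F G t))"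
    by (rule linear_comp[OF linear_tensor_map linear_tensor_map])
  show "tensor_map F' G' (tensor_map F G (basis x)) = tensor_map (F' \<circ> F) (G' \<circ> G) (basis x)" for x
    by (cases x) (simp add: tensor_map_tensor[OF assms])
qed (rule linear_tensor_map)

text \<open>The coproduct of a generator \<open>a\<close> is \<open>1 \<otimes> a\<close>, plus
  \<open>a \<otimes> 1\<close>, plus the part in \<open>red_coproduct'\<close>. Setting the result
  to zero and solving for one map while the other is the identity gives the left or the right
  recursion.\<close>

lemma convolution_generator:
  fixes \<Delta> :: "'m::finite H \<Rightarrow> 'm HH" and F G :: "'m H \<Rightarrow> 'm H"
  assumes "is_coproduct \<Delta>" "linear F" "linear G" "F 1 = 1" "G 1 = 1"
  shows "mult (tensor_map F G (\<Delta> (incl (coord i \<eta>)))) = G (incl (coord i \<eta>)) + F (incl (coord i \<eta>)) +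
    mult (tensor_map (F \<circ> incl) G (red_coproduct' (lin_ext (\<lambda>(i, \<eta>). red_cop i \<eta>)) (coord i \<eta>)))"
proof -
  let ?t = "red_coproduct' (lin_ext (\<lambda>(i, \<eta>). red_cop i \<eta>)) (coord i \<eta>)"
  have lin: "linear (\<lambda>t. mult (tensor_map F' G t))" for F' :: "'a Vplus \<Rightarrow> 'm H"
    by (rule linear_comp[OF linear_tensor_map linear_mult])
  have "\<Delta> (incl (coord i \<eta>)) = tensor 1 (incl (coord i \<eta>)) + tensor_map incl id (tensor (coord i \<eta>) 1 + ?t)"
    using tensor_map_incl_red_cop[OF assms(1), of i \<eta>] by (simp add: red_coproduct'_def) (simp add: coord_def)
  also have "tensor_map incl id (tensor (coord i \<eta>) 1 + ?t) =
      tensor (incl (coord i \<eta>)) 1 + tensor_map incl id ?t"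
    by (simp add: linear_add[OF linear_tensor_map] tensor_map_tensor linear_incl linear_id)
  finally show ?thesis
    using assms by (simp add: linear_add[OF linear_tensor_map] linear_add[OF linear_mult]
        tensor_map_tensor tensor_map_comp mult_tensor)
qed

text \<open>The first factors on the right-hand side are single coordinates of smaller weight, so
  induction on the weight never meets a value of \<open>R\<close> on a product.\<close>

lemma antipode_left_rec_unique:
  fixes R R' :: "'m::finite Vplus \<Rightarrow> 'm H"
  assumes "linear R" "linear R'"
    "antipode_left_rec (lin_ext (\<lambda>(i, \<eta>). red_cop i \<eta>)) R"
    "antipode_left_rec (lin_ext (\<lambda>(i, \<eta>). red_cop i \<eta>)) R'"
  shows "R = R'"
proof -
  have "R (coord i \<eta>) = R' (coord i \<eta>)" for i \<eta>
  proof (induction "weight \<eta>" arbitrary: i \<eta> rule: less_induct)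
    case less
    let ?t = "red_coproduct' (lin_ext (\<lambda>(i, \<eta>). red_cop i \<eta>)) (coord i \<eta>)"
    have "tensor_map R id ?t = tensor_map R' id ?t"
      unfolding tensor_map_def
    proof (rule lin_ext_cong[OF refl])
      fix z
      assume "z \<in> Poly_Mapping.keys ?t"
      then obtain j \<xi> p where z: "z = ((j, \<xi>), p)" "weight \<xi> < weight \<eta>"
        using keys_red_cop[of i \<eta>] by (auto simp: red_coproduct'_def coord_def)
      then show "(case z of (x, y) \<Rightarrow> tensor (R (basis x)) (id (basis y))) =
          (case z of (x, y) \<Rightarrow> tensor (R' (basis x)) (id (basis y)))"
        using less[of \<xi> j] by (simp add: coord_def)
    qed
    then show ?case using assms(3,4) by (simp add: antipode_left_rec_def)
  qed
  then have on_basis: "R (basis x) = R' (basis x)" for x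
    by (cases x) (simp add: coord_def)
  have "R v = R' v" for v
    by (rule linear_eq_on_basis[OF assms(1,2) on_basis])
  then show ?thesis by blast
qed

theorem theorem5:
  fixes \<Delta> :: "'m::finite H \<Rightarrow> 'm HH" and S :: "'m H \<Rightarrow> 'm H"
  assumes "is_coproduct \<Delta>" and "is_antipode \<Delta> S"
  shows "\<exists>Dsh T.
    (\<forall>Dsh'. shuffle_coproduct_rec Dsh' \<longleftrightarrow> Dsh' = Dsh) \<and>
    (\<forall>T'. red_coproduct_rec Dsh T' \<longleftrightarrow> T' = T) \<and>
    (\<forall>v. tensor_map incl id (T v) = \<Delta> (incl v) - tensor 1 (incl v)) \<and>
    antipode_left_rec T (S \<circ> incl) \<and>
    antipode_right_rec T S \<and>
    (\<forall>R. linear R \<and> antipode_left_rec T R \<longrightarrow> R = S \<circ> incl) \<and>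
    (\<forall>R. unital_alg_hom R \<and> antipode_right_rec T R \<longrightarrow> R = S)"
proof -
  let ?Dsh = "\<lambda>j. lin_ext (\<lambda>(i, \<eta>). shuffle_cop j i \<eta>)"
  let ?T = "lin_ext (\<lambda>(i, \<eta>). red_cop i \<eta>)"
  have S: "linear S" and S_left: "\<And>p. mult (tensor_map S id (\<Delta> p)) = counit p *\<^sub>R 1"
    and S_right: "\<And>p. mult (tensor_map id S (\<Delta> p)) = counit p *\<^sub>R 1"
    using assms(2) by (auto simp: is_antipode_def)
  \<comment> \<open>The expansion in \<open>convolution_generator\<close> requires maps that
    preserve 1; for \<open>S\<close> this is the left antipode identity at 1.\<close>
  have "\<Delta> 1 = basis (0, 0)"
    using assms(1) by (simp add: is_coproduct_def unital_alg_hom_def basis_0 flip: zero_prod_def)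
  then have S_one: "S 1 = 1"
    using S_left[of 1] by (simp add: mult_tensor basis_0 counit_def)
  have counit_gen: "counit (incl (coord i \<eta>)) = 0" for i and \<eta> :: "'m word"
    using counit_basis_add[of 0 "(i, \<eta>)"] by (simp add: coord_def)
  have left: "antipode_left_rec ?T (S \<circ> incl)"
    unfolding antipode_left_rec_def
  proof (intro allI)
    fix i and \<eta> :: "'m word"
    show "(S \<circ> incl) (coord i \<eta>) =
        - incl (coord i \<eta>) - mult (tensor_map (S \<circ> incl) id (red_coproduct' ?T (coord i \<eta>)))"
      using convolution_generator[OF assms(1) S linear_id S_one, of i \<eta>] S_left[of "incl (coord i \<eta>)"]
      by (simp add: counit_gen algebra_simps add_eq_0_iff)
  qed
  \<comment> \<open>For a normalized linear map the right recursion says exactly that its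
    convolution with the identity vanishes on generators.\<close>
  have right_iff: "antipode_right_rec ?T R \<longleftrightarrow> (\<forall>i \<eta>. mult (tensor_map id R (\<Delta> (incl (coord i \<eta>)))) = 0)"
    if "linear R" "R 1 = 1" for R
    using convolution_generator[OF assms(1) linear_id that(1) _ that(2)]
    by (simp add: antipode_right_rec_def algebra_simps add_eq_0_iff)
  have right: "antipode_right_rec ?T S"
    by (simp add: right_iff[OF S S_one] S_right counit_gen)
  \<comment> \<open>Multiplicativity of \<open>R\<close> extends this vanishing from generators to
    the counit law on all of \<open>H\<close>, where \<open>R\<close> can be compared with
    \<open>S\<close> degree by degree.\<close>
  have "R = S" if R: "unital_alg_hom R" "antipode_right_rec ?T R" for R
  proof (rule right_convolution_cancel[OF assms(1) _ S])
    show "linear R" using R(1) by (simp add: unital_alg_hom_def)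
    show "mult (tensor_map id R (\<Delta> p)) = mult (tensor_map id S (\<Delta> p))" for p
      using right_convolution_counit[OF assms(1) R(1), of p] R
      by (simp add: S_right right_iff unital_alg_hom_def)
  qed
  moreover have "linear (S \<circ> incl)"
    using linear_comp[OF linear_incl S] by (simp add: comp_def)
  ultimately show ?thesis
    using shuffle_coproduct_rec_iff red_coproduct_rec_iff red_coproduct_identity[OF assms(1)]
      left right antipode_left_rec_unique[OF _ \<open>linear (S \<circ> incl)\<close> _ left]
    by (intro exI[of _ ?Dsh] exI[of _ ?T]) blast
qed

end
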